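(* Let $(X,\{R_i\}_{i=0}^4)$ be a symmetric association scheme with $4$ classes that is $Q$-polynomial with respect to an ordering $E_0,\dots,E_4$ of its primitive idempotents and that is both $Q$-antipodal and $Q$-bipartite. Let $f$ be the number of its $Q$-antipodal classes and let $2d$ be the size of each $Q$-antipodal class. Then the following conditions are equivalent: (1) $(X,\{R_i\}_{i=0}^4)$ is quadruply regular; (2) $f=\frac d2+1$.
   Context: Let $(X,\{R_i\}_{i=0}^D)$ be a symmetric association scheme ($X$ finite, $R_0$ the diagonal relation) with adjacency matrices $A_i$ and primitive idempotents $E_0=\frac1{|X|}J,E_1,\dots,E_D$. The Krein numbers $q_{i,j}^k$ are defined by $E_i\circ E_j=\frac1{|X|}\sum_{k}q_{i,j}^kE_k$, where $\circ$ is the entrywise product. The scheme is $Q$-polynomial with respect to the ordering $E_0,E_1,\dots,E_D$ if for each $i$ there is a polynomial $v_i^*$ of degree $i$ such that $|X|E_i$ is obtained by applying $v_i^*$ entrywise to $|X|E_1$. In this case put $a_i^*=q_{1,i}^i$, $b_i^*=q_{1,i+1}^i$, $c_i^*=q_{1,i-1}^i$. A $Q$-polynomial scheme is $Q$-bipartite if $a_i^*=0$ for all $i$. It is $Q$-antipodal if $b_j^*=c_{D-j}^*$ for all $0\le j\le D$ except possibly $j=\lfloor D/2\rfloor$ (with $b_D^*=c_0^*=0$). For a $Q$-antipodal scheme, $E_0+E_D$ is a scalar multiple of the adjacency matrix of an equivalence relation on $X$ that is a union of some $R_i$; its equivalence classes, which all have the same size, are called the $Q$-antipodal classes. (Such $4$-class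 schemes are exactly those obtained from collections of $f$ real mutually unbiased bases $M=\{M_1,\dots,M_f\}$ of $\mathbb R^d$, i.e. orthonormal bases such that $\langle x,y\rangle=\pm1/\sqrt d$ for $x,y$ in different bases, by taking $X=M\cup(-M)$, where $M$ also denotes the union of the bases, and letting $R_0,R_1,R_2,R_3,R_4$ be the relations on $X$ given by inner products $1,\frac1{\sqrt d},0,-\frac1{\sqrt d},-1$, respectively; the $Q$-antipodal classes are the sets $M_i\cup(-M_i)$.) For $x\in X$ write $R_i(x)=\{y\in X\mid (x,y)\in R_i\}$. A symmetric association scheme $(X,\{R_i\}_{i=0}^D)$ is quadruply regular if for all $(i_1,i_2,i_3,i_4)\in\{0,\dots,D\}^4$, all $(j_{\alpha,\beta})_{1\le\alpha<\beta\le4}\in\{0,\dots,D\}^6$ and all $x_1,\dots,x_4\in X$ with $(x_k,x_l)\in R_{j_{k,l}}$ for $1\le k<l\le4$, the number $|R_{i_1}(x_1)\cap R_{i_2}(x_2)\cap R_{i_3}(x_3)\cap R_{i_4}(x_4)|$ depends only on $(i_1,\dots,i_4)$ and $(j_{\alpha,\beta})$ and not on $x_1,\dots,x_4$. *)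

theory Defs
  imports "HOL-Analysis.Analysis" "HOL-Computational_Algebra.Polynomial"
begin

text \<open>
  The point set \<open>X\<close> is the universe of a finite type \<open>'a\<close>; matrices indexed by \<open>X\<close> have
  type \<open>real^'a^'a\<close>. Only the values \<open>R i\<close> and \<open>E i\<close> with \<open>i \<le> D\<close> matter below.
\<close>

locale symmetric_association_scheme =
  fixes D :: nat and R :: "nat \<Rightarrow> 'a::finite rel"
  assumes diagonal: "R 0 = Id"
    and nonempty: "\<And>i. i \<le> D \<Longrightarrow> R i \<noteq> {}"
    and covering: "(\<Union>i\<le>D. R i) = UNIV"
    and disjoint: "\<And>i j. i \<le> D \<Longrightarrow> j \<le> D \<Longrightarrow> i \<noteq> j \<Longrightarrow> R i \<inter> R j = {}"
    and symmetric: "\<And>i. i \<le> D \<Longrightarrow> sym (R i)"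
    and intersection_numbers:
      "\<And>i j k. i \<le> D \<Longrightarrow> j \<le> D \<Longrightarrow> k \<le> D \<Longrightarrow>
        \<exists>p. \<forall>x y. (x, y) \<in> R k \<longrightarrow> card {z. (x, z) \<in> R i \<and> (z, y) \<in> R j} = p"

definition adjacency_matrix :: "'a::finite rel \<Rightarrow> real^'a^'a" where
  "adjacency_matrix r = (\<chi> x y. if (x, y) \<in> r then 1 else 0)"

definition bose_mesner :: "nat \<Rightarrow> (nat \<Rightarrow> 'a::finite rel) \<Rightarrow> (real^'a^'a) set" where
  "bose_mesner D R = span ((\<lambda>i. adjacency_matrix (R i)) ` {..D})"

definition idempotents :: "nat \<Rightarrow> (nat \<Rightarrow> 'a::finite rel) \<Rightarrow> (real^'a^'a) set" where
  "idempotents D R = {F \<in> bose_mesner D R. F ** F = F}"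

definition primitive_idempotents :: "nat \<Rightarrow> (nat \<Rightarrow> 'a::finite rel) \<Rightarrow> (real^'a^'a) set" where
  "primitive_idempotents D R = {P \<in> idempotents D R. P \<noteq> 0 \<and>
     \<not> (\<exists>F\<in>idempotents D R. \<exists>G\<in>idempotents D R.
          F \<noteq> 0 \<and> G \<noteq> 0 \<and> F ** G = 0 \<and> G ** F = 0 \<and> P = F + G)}"

definition idempotent_ordering ::
    "nat \<Rightarrow> (nat \<Rightarrow> 'a::finite rel) \<Rightarrow> (nat \<Rightarrow> real^'a^'a) \<Rightarrow> bool" where
  "idempotent_ordering D R E \<longleftrightarrow>
     bij_betw E {..D} (primitive_idempotents D R) \<and> E 0 = (\<chi> x y. 1 / real CARD('a))"

definition entrywise_product :: "real^'a^'a \<Rightarrow> real^'a^'a \<Rightarrow> real^'a^'a::finite" where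
  "entrywise_product A B = (\<chi> x y. A $ x $ y * B $ x $ y)"

text \<open>
  \<open>krein D E i j k\<close> is the Krein number \<open>q\<^sub>i\<^sub>,\<^sub>j\<^sup>k\<close>. For \<open>i, j \<le> D\<close> the coefficients exist and are
  unique because the primitive idempotents form a basis of the Bose-Mesner algebra, which is
  closed under the entrywise product; the values at \<open>k > D\<close> are fixed to \<open>0\<close> to make the whole
  function \<open>q\<close> unique.
\<close>

definition krein :: "nat \<Rightarrow> (nat \<Rightarrow> real^'a^'a::finite) \<Rightarrow> nat \<Rightarrow> nat \<Rightarrow> nat \<Rightarrow> real" where
  "krein D E i j = (THE q. (\<forall>k>D. q k = 0) \<and>
     entrywise_product (E i) (E j) = (1 / real CARD('a)) *\<^sub>R (\<Sum>k\<le>D. q k *\<^sub>R E k))"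

definition a_star :: "nat \<Rightarrow> (nat \<Rightarrow> real^'a^'a::finite) \<Rightarrow> nat \<Rightarrow> real" where
  "a_star D E i = krein D E 1 i i"

definition b_star :: "nat \<Rightarrow> (nat \<Rightarrow> real^'a^'a::finite) \<Rightarrow> nat \<Rightarrow> real" where
  "b_star D E i = (if i < D then krein D E 1 (i + 1) i else 0)"

definition c_star :: "nat \<Rightarrow> (nat \<Rightarrow> real^'a^'a::finite) \<Rightarrow> nat \<Rightarrow> real" where
  "c_star D E i = (if i = 0 then 0 else krein D E 1 (i - 1) i)"

definition Q_polynomial :: "nat \<Rightarrow> (nat \<Rightarrow> real^'a^'a::finite) \<Rightarrow> bool" where
  "Q_polynomial D E \<longleftrightarrow> (\<forall>i\<le>D. \<exists>v :: real poly. degree v = i \<and>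
     (\<forall>x y. real CARD('a) * E i $ x $ y = poly v (real CARD('a) * E 1 $ x $ y)))"

definition Q_bipartite :: "nat \<Rightarrow> (nat \<Rightarrow> real^'a^'a::finite) \<Rightarrow> bool" where
  "Q_bipartite D E \<longleftrightarrow> (\<forall>i\<le>D. a_star D E i = 0)"

definition Q_antipodal :: "nat \<Rightarrow> (nat \<Rightarrow> real^'a^'a::finite) \<Rightarrow> bool" where
  "Q_antipodal D E \<longleftrightarrow> (\<forall>j\<le>D. j \<noteq> D div 2 \<longrightarrow> b_star D E j = c_star D E (D - j))"

text \<open>
  For a Q-antipodal scheme \<open>E 0 + E D\<close> is a nonzero scalar multiple of the adjacency matrix of
  an equivalence relation; that relation is therefore the support of \<open>E 0 + E D\<close>.
\<close>

definition Q_antipodal_relation :: "nat \<Rightarrow> (nat \<Rightarrow> real^'a^'a::finite) \<Rightarrow> 'a rel" where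
  "Q_antipodal_relation D E = {(x, y). (E 0 + E D) $ x $ y \<noteq> 0}"

definition Q_antipodal_classes :: "nat \<Rightarrow> (nat \<Rightarrow> real^'a^'a::finite) \<Rightarrow> 'a set set" where
  "Q_antipodal_classes D E = UNIV // Q_antipodal_relation D E"

text \<open>
  The set \<open>R\<^sub>i(x)\<close> is \<open>R i `` {x}\<close>. Tuples are functions on \<open>nat\<close> of which only the values at the
  indices \<open>1, \<dots>, 4\<close> (pairs \<open>k < l\<close> of such, for \<open>j\<close>) are used.
\<close>

definition quadruply_regular :: "nat \<Rightarrow> (nat \<Rightarrow> 'a::finite rel) \<Rightarrow> bool" where
  "quadruply_regular D R \<longleftrightarrow>
     (\<forall>(i :: nat \<Rightarrow> nat) (j :: nat \<Rightarrow> nat \<Rightarrow> nat).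
        (\<forall>k\<in>{1..4}. i k \<le> D) \<longrightarrow>
        (\<forall>k\<in>{1..4}. \<forall>l\<in>{1..4}. k < l \<longrightarrow> j k l \<le> D) \<longrightarrow>
        (\<exists>N. \<forall>x :: nat \<Rightarrow> 'a.
           (\<forall>k\<in>{1..4}. \<forall>l\<in>{1..4}. k < l \<longrightarrow> (x k, x l) \<in> R (j k l)) \<longrightarrow>
           card (\<Inter>k\<in>{1..4}. R (i k) `` {x k}) = N))"

end

theory Submission
  imports Defs
begin

text \<open>
  The Krein parameters of a Q-bipartite, Q-antipodal scheme with four classes are determined by the
  rank \<open>m\<close> of \<open>E 1\<close> and one further number, and the entries of \<open>|X| E 1\<close> turn out to be \<open>\<plusminus>m\<close>,
  \<open>\<plusminus>\<surd>m\<close> and \<open>0\<close>. Hence the points are unit vectors of \<open>\<real>\<^sup>m\<close> forming real mutually unbiased bases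
  and their negatives; the bases are the Q-antipodal classes and \<open>m = d\<close>.

  Consider the fourth moments \<open>\<Sum>u. \<langle>u, x\<rangle> \<langle>u, y\<rangle> \<langle>u, z\<rangle> \<langle>u, w\<rangle>\<close>. For \<open>x = y\<close> they are explicit and
  involve the constant \<open>\<gamma> = 2 (f - 1) / d\<close>. If \<open>\<gamma> = 1\<close>, a sum of squares shows that the points form a
  spherical 5-design, so the fourth moments, and then all quadruple intersection numbers, are determined by
  inner products. Conversely, quadruple regularity forces the moment of four orthogonal vectors of one
  basis to vanish. For distinct orthogonal \<open>x\<close>, \<open>y\<close> of one basis the sum of the squared moments over
  \<open>z\<close>, \<open>w\<close> in that basis is \<open>8 \<gamma>\<close> in general and \<open>8 \<gamma>\<^sup>2\<close> in the regular case, so \<open>\<gamma> = 1\<close>.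
\<close>

section \<open>The Bose-Mesner algebra\<close>

lemma matrix_add_rdistrib: "(A + B) ** C = A ** C + B ** (C :: real^'n^'m)"
  by (simp add: vec_eq_iff matrix_matrix_mult_def algebra_simps sum.distrib)

lemma matrix_diff_ldistrib: "A ** (B - C) = A ** B - A ** (C :: real^'n^'m)"
  by (simp add: vec_eq_iff matrix_matrix_mult_def algebra_simps sum_subtractf)

lemma matrix_diff_rdistrib: "(A - B) ** C = A ** C - B ** (C :: real^'n^'m)"
  by (simp add: vec_eq_iff matrix_matrix_mult_def algebra_simps sum_subtractf)

lemma matrix_sum_scaleR_mult:
  "(\<Sum>k\<in>K. c k *\<^sub>R A k) ** B = (\<Sum>k\<in>K. c k *\<^sub>R (A k ** (B :: real^'n^'m)))"
proof -
  have "(\<Sum>z\<in>UNIV. (\<Sum>k\<in>K. c k * A k $ x $ z) * B $ z $ y) = (\<Sum>k\<in>K. c k * (\<Sum>z\<in>UNIV. A k $ x $ z * B $ z $ y))" for x y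
    unfolding sum_distrib_left sum_distrib_right by (subst sum.swap) (simp add: mult.assoc)
  then show ?thesis by (simp add: vec_eq_iff matrix_matrix_mult_def)
qed

context symmetric_association_scheme
begin

abbreviation "BM \<equiv> bose_mesner D R"

lemma ex_rel: "\<exists>i\<le>D. (x, y) \<in> R i"
  using covering by blast

lemma rel_unique: "(x, y) \<in> R i \<Longrightarrow> (x, y) \<in> R j \<Longrightarrow> i \<le> D \<Longrightarrow> j \<le> D \<Longrightarrow> i = j"
  using disjoint by blast

lemma rel_sym: "i \<le> D \<Longrightarrow> (x, y) \<in> R i \<longleftrightarrow> (y, x) \<in> R i"
  using symmetric[of i] by (auto dest: symD)

lemma sum_adjacency:
  assumes "(x, y) \<in> R i" "i \<le> D"
  shows "(\<Sum>j\<le>D. c j *\<^sub>R adjacency_matrix (R j)) $ x $ y = c i"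
proof -
  have "j \<le> D \<Longrightarrow> (x, y) \<in> R j \<longleftrightarrow> j = i" for j using assms rel_unique by blast
  then have "(\<Sum>j\<le>D. c j * (if (x, y) \<in> R j then 1 else 0)) = (\<Sum>j\<le>D. if j = i then c j else 0)"
    by (intro sum.cong refl) auto
  then show ?thesis using assms by (simp add: adjacency_matrix_def)
qed

text \<open>The relations partition the pairs of points, so a matrix constant on each of them is
  read off as a combination of adjacency matrices. Closure properties of the algebra are checked in
  this form.\<close>

lemma BM_iff:
  "M \<in> BM \<longleftrightarrow> (\<forall>i\<le>D. \<exists>\<theta>. \<forall>x y. (x, y) \<in> R i \<longrightarrow> M $ x $ y = \<theta>)"
proof
  assume "M \<in> BM"
  then show "\<forall>i\<le>D. \<exists>\<theta>. \<forall>x y. (x, y) \<in> R i \<longrightarrow> M $ x $ y = \<theta>"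
    unfolding bose_mesner_def
  proof (induction rule: span_induct_alt)
    case base
    then show ?case by auto
  next
    case (step c B M)
    then obtain j where j: "j \<le> D" "B = adjacency_matrix (R j)" by auto
    show ?case
    proof (intro allI impI)
      fix i assume "i \<le> D"
      then obtain \<theta> where "\<And>x y. (x, y) \<in> R i \<Longrightarrow> M $ x $ y = \<theta>" using step by blast
      moreover have "(x, y) \<in> R i \<Longrightarrow> B $ x $ y = of_bool (i = j)" for x y
        using j \<open>i \<le> D\<close> by (auto simp: adjacency_matrix_def dest: rel_unique)
      ultimately show "\<exists>\<theta>. \<forall>x y. (x, y) \<in> R i \<longrightarrow> (c *\<^sub>R B + M) $ x $ y = \<theta>"
        by (intro exI[of _ "c * of_bool (i = j) + \<theta>"]) auto
    qed
  qed
next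
  assume "\<forall>i\<le>D. \<exists>\<theta>. \<forall>x y. (x, y) \<in> R i \<longrightarrow> M $ x $ y = \<theta>"
  then obtain \<theta> where \<theta>: "\<And>i x y. i \<le> D \<Longrightarrow> (x, y) \<in> R i \<Longrightarrow> M $ x $ y = \<theta> i" by metis
  have "M = (\<Sum>j\<le>D. \<theta> j *\<^sub>R adjacency_matrix (R j))"
  proof -
    have "M $ x $ y = (\<Sum>j\<le>D. \<theta> j *\<^sub>R adjacency_matrix (R j)) $ x $ y" for x y
      using ex_rel[of x y] \<theta> by (metis sum_adjacency)
    then show ?thesis unfolding vec_eq_iff by blast
  qed
  moreover have "(\<Sum>j\<le>D. \<theta> j *\<^sub>R adjacency_matrix (R j)) \<in> BM"
    unfolding bose_mesner_def by (intro span_sum span_scale span_base) auto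
  ultimately show "M \<in> BM" by simp
qed

lemma BM_values: "M \<in> BM \<Longrightarrow> \<exists>\<theta>. \<forall>i\<le>D. \<forall>x y. (x, y) \<in> R i \<longrightarrow> M $ x $ y = \<theta> i"
  unfolding BM_iff by metis

lemma BM_sym:
  assumes "M \<in> BM"
  shows "M $ x $ y = M $ y $ x"
proof -
  obtain \<theta> where \<theta>: "\<And>i x y. i \<le> D \<Longrightarrow> (x, y) \<in> R i \<Longrightarrow> M $ x $ y = \<theta> i"
    using BM_values[OF assms] by blast
  obtain i where "i \<le> D" "(x, y) \<in> R i" using ex_rel by blast
  then show ?thesis using \<theta>[of i x y] \<theta>[of i y x] rel_sym[of i x y] by simp
qed

lemma BM_diag:
  assumes "M \<in> BM"
  shows "M $ x $ x = M $ y $ y"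
proof -
  obtain \<theta> where \<theta>: "\<And>i x y. i \<le> D \<Longrightarrow> (x, y) \<in> R i \<Longrightarrow> M $ x $ y = \<theta> i"
    using BM_values[OF assms] by blast
  show ?thesis using \<theta>[of 0 x x] \<theta>[of 0 y y] diagonal by simp
qed

lemma BM_subspace: "subspace BM"
  unfolding bose_mesner_def by (rule subspace_span)

lemma BM_mat_1: "mat 1 \<in> BM"
  unfolding BM_iff
proof (intro allI impI)
  fix i assume "i \<le> D"
  then show "\<exists>\<theta>. \<forall>x y. (x, y) \<in> R i \<longrightarrow> (mat 1 :: real^'a^'a) $ x $ y = \<theta>"
    using rel_unique[of _ _ i 0]
    by (intro exI[of _ "of_bool (i = 0)"]) (cases "i = 0"; auto simp: mat_def diagonal)
qed

lemma BM_entrywise: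
  assumes "M \<in> BM" "N \<in> BM"
  shows "entrywise_product M N \<in> BM"
proof -
  obtain \<mu> where \<mu>: "\<And>i x y. i \<le> D \<Longrightarrow> (x, y) \<in> R i \<Longrightarrow> M $ x $ y = \<mu> i"
    using BM_values[OF assms(1)] by blast
  obtain \<nu> where \<nu>: "\<And>i x y. i \<le> D \<Longrightarrow> (x, y) \<in> R i \<Longrightarrow> N $ x $ y = \<nu> i"
    using BM_values[OF assms(2)] by blast
  have "entrywise_product M N $ x $ y = \<mu> i * \<nu> i" if "i \<le> D" "(x, y) \<in> R i" for i x y
    using that by (simp add: entrywise_product_def \<mu> \<nu>)
  then show ?thesis unfolding BM_iff by blast
qed

text \<open>Sorting the intermediate points \<open>z\<close> by the relations of
  \<open>(x, z)\<close> and \<open>(z, y)\<close> turns an entry of the product into a sum weighted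
  by intersection numbers, which do not depend on the pair chosen in \<open>R k\<close>.\<close>

lemma BM_mult:
  assumes "M \<in> BM" "N \<in> BM"
  shows "M ** N \<in> BM"
  unfolding BM_iff
proof (intro allI impI)
  fix k assume k: "k \<le> D"
  obtain \<mu> where \<mu>: "\<And>i x y. i \<le> D \<Longrightarrow> (x, y) \<in> R i \<Longrightarrow> M $ x $ y = \<mu> i"
    using BM_values[OF assms(1)] by blast
  obtain \<nu> where \<nu>: "\<And>i x y. i \<le> D \<Longrightarrow> (x, y) \<in> R i \<Longrightarrow> N $ x $ y = \<nu> i"
    using BM_values[OF assms(2)] by blast
  define p where "p i j = (SOME q. \<forall>x y. (x, y) \<in> R k \<longrightarrow> card {z. (x, z) \<in> R i \<and> (z, y) \<in> R j} = q)" for i j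
  have p: "card {z. (x, z) \<in> R i \<and> (z, y) \<in> R j} = p i j"
    if "i \<le> D" "j \<le> D" "(x, y) \<in> R k" for i j x y
    using someI_ex[OF intersection_numbers[OF that(1,2) k]] that(3) unfolding p_def by blast
  have "(M ** N) $ x $ y = (\<Sum>i\<le>D. \<Sum>j\<le>D. \<mu> i * \<nu> j * real (p i j))" if xy: "(x, y) \<in> R k" for x y
  proof -
    have "M $ x $ z * N $ z $ y = (\<Sum>i\<le>D. \<Sum>j\<le>D. \<mu> i * \<nu> j * of_bool ((x, z) \<in> R i \<and> (z, y) \<in> R j))" for z
    proof -
      obtain i0 j0 where ij: "i0 \<le> D" "(x, z) \<in> R i0" "j0 \<le> D" "(z, y) \<in> R j0"
        using ex_rel by blast
      have "(\<Sum>i\<le>D. \<Sum>j\<le>D. \<mu> i * \<nu> j * of_bool ((x, z) \<in> R i \<and> (z, y) \<in> R j))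
          = (\<Sum>i\<le>D. \<Sum>j\<le>D. if i = i0 then if j = j0 then \<mu> i * \<nu> j else 0 else 0)"
      proof (intro sum.cong refl)
        fix i j assume "i \<in> {..D}" "j \<in> {..D}"
        then have "(x, z) \<in> R i \<longleftrightarrow> i = i0" "(z, y) \<in> R j \<longleftrightarrow> j = j0"
          using ij rel_unique by (metis atMost_iff)+
        then show "\<mu> i * \<nu> j * of_bool ((x, z) \<in> R i \<and> (z, y) \<in> R j)
            = (if i = i0 then if j = j0 then \<mu> i * \<nu> j else 0 else 0)" by simp
      qed
      also have "\<dots> = (\<Sum>i\<le>D. if i = i0 then \<mu> i * \<nu> j0 else 0)"
        using ij by (intro sum.cong refl) simp
      finally show ?thesis using ij by (simp add: \<mu>[OF ij(1,2)] \<nu>[OF ij(3,4)])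
    qed
    then have "(M ** N) $ x $ y = (\<Sum>z\<in>UNIV. \<Sum>i\<le>D. \<Sum>j\<le>D. \<mu> i * \<nu> j * of_bool ((x, z) \<in> R i \<and> (z, y) \<in> R j))"
      by (simp add: matrix_matrix_mult_def)
    also have "\<dots> = (\<Sum>i\<le>D. \<Sum>j\<le>D. \<Sum>z\<in>UNIV. \<mu> i * \<nu> j * of_bool ((x, z) \<in> R i \<and> (z, y) \<in> R j))"
      by (subst sum.swap, subst (2) sum.swap) rule
    also have "\<dots> = (\<Sum>i\<le>D. \<Sum>j\<le>D. \<mu> i * \<nu> j * real (p i j))"
    proof (intro sum.cong refl)
      fix i j assume "i \<in> {..D}" "j \<in> {..D}"
      then have "real (p i j) = (\<Sum>z\<in>UNIV. of_bool ((x, z) \<in> R i \<and> (z, y) \<in> R j))"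
        using p[OF _ _ xy, of i j] by simp
      then show "(\<Sum>z\<in>UNIV. \<mu> i * \<nu> j * of_bool ((x, z) \<in> R i \<and> (z, y) \<in> R j)) = \<mu> i * \<nu> j * real (p i j)"
        by (simp only: sum_distrib_left)
    qed
    finally show ?thesis .
  qed
  then show "\<exists>\<theta>. \<forall>x y. (x, y) \<in> R k \<longrightarrow> (M ** N) $ x $ y = \<theta>" by blast
qed

text \<open>The matrices \<open>M\<close>, \<open>N\<close> and \<open>N ** M\<close> are all
  symmetric, and the transpose of \<open>N ** M\<close> is \<open>M ** N\<close>.\<close>

lemma BM_commute:
  assumes "M \<in> BM" "N \<in> BM"
  shows "M ** N = N ** M"
proof -
  have "(M ** N) $ x $ y = (N ** M) $ x $ y" for x y
  proof -
    have "(M ** N) $ x $ y = (N ** M) $ y $ x"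
      by (simp add: matrix_matrix_mult_def BM_sym[OF assms(1), of x] BM_sym[OF assms(2), of _ y] mult.commute)
    then show ?thesis using BM_sym[OF BM_mult[OF assms(2,1)]] by simp
  qed
  then show ?thesis unfolding vec_eq_iff by blast
qed

lemma dim_BM: "dim BM \<le> D + 1"
proof -
  have "dim BM \<le> card ((\<lambda>i. adjacency_matrix (R i)) ` {..D})"
    unfolding bose_mesner_def dim_span by (rule dim_le_card') simp
  also have "\<dots> \<le> card {..D}" by (rule card_image_le) simp
  finally show ?thesis by simp
qed

text \<open>By commutativity \<open>P ** Q\<close> and \<open>P - P ** Q\<close> are orthogonal
  idempotents with sum \<open>P\<close>. If \<open>P ** Q\<close> is nonzero, primitivity of
  \<open>P\<close> leaves only \<open>P ** Q = P\<close>; exchanging the roles gives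
  \<open>P = Q\<close>.\<close>

lemma primitive_mult_eq_0:
  assumes "P \<in> primitive_idempotents D R" "Q \<in> primitive_idempotents D R" "P \<noteq> Q"
  shows "P ** Q = 0"
proof (rule ccontr)
  assume ne: "P ** Q \<noteq> 0"
  have absorb: "P ** Q = P" if PQ: "P \<in> primitive_idempotents D R" "Q \<in> primitive_idempotents D R" "P ** Q \<noteq> 0" for P Q
  proof (rule ccontr)
    assume "P ** Q \<noteq> P"
    have BM: "P \<in> BM" "Q \<in> BM" and idem: "P ** P = P" "Q ** Q = Q"
      using PQ unfolding primitive_idempotents_def idempotents_def by auto
    have comm: "Q ** P = P ** Q" using BM_commute[OF BM] by simp
    have PPQ: "P ** (P ** Q) = P ** Q" "(P ** Q) ** P = P ** Q" "(P ** Q) ** (P ** Q) = P ** Q"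
      by (metis comm idem matrix_mul_assoc)+
    have "P ** Q \<in> idempotents D R" "P - P ** Q \<in> idempotents D R"
      using BM PPQ idem unfolding idempotents_def
      by (auto intro: BM_mult subspace_diff[OF BM_subspace]
          simp: matrix_diff_ldistrib matrix_diff_rdistrib)
    moreover have "(P ** Q) ** (P - P ** Q) = 0" "(P - P ** Q) ** (P ** Q) = 0"
      using PPQ by (auto simp: matrix_diff_ldistrib matrix_diff_rdistrib)
    moreover have "P = P ** Q + (P - P ** Q)" "P - P ** Q \<noteq> 0" using \<open>P ** Q \<noteq> P\<close> by auto
    ultimately show False using PQ unfolding primitive_idempotents_def by blast
  qed
  have BM: "P \<in> BM" "Q \<in> BM"
    using assms unfolding primitive_idempotents_def idempotents_def by auto
  have "P = P ** Q" using absorb[OF assms(1,2) ne] by simp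
  also have "\<dots> = Q ** P" by (rule BM_commute[OF BM])
  also have "\<dots> = Q" using absorb[OF assms(2,1)] ne BM_commute[OF BM] by simp
  finally show False using assms(3) by simp
qed

end

section \<open>Primitive idempotents as a basis, and Krein numbers\<close>

locale ordered_scheme = symmetric_association_scheme D R
  for D and R :: "nat \<Rightarrow> 'a::finite rel" +
  fixes E :: "nat \<Rightarrow> real^'a^'a"
  assumes ordering: "idempotent_ordering D R E"
begin

lemma E_primitive: "i \<le> D \<Longrightarrow> E i \<in> primitive_idempotents D R"
  using ordering unfolding idempotent_ordering_def by (auto dest: bij_betwE)

lemma E_BM: "i \<le> D \<Longrightarrow> E i \<in> BM"
  using E_primitive unfolding primitive_idempotents_def idempotents_def by blast

lemma E_nonzero: "i \<le> D \<Longrightarrow> E i \<noteq> 0"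
  using E_primitive unfolding primitive_idempotents_def by blast

lemma E_sym: "i \<le> D \<Longrightarrow> E i $ x $ y = E i $ y $ x"
  by (rule BM_sym[OF E_BM])

lemma E_0: "E 0 $ x $ y = 1 / real CARD('a)"
  using ordering unfolding idempotent_ordering_def by simp

lemma E_inj: "inj_on E {..D}"
  using ordering unfolding idempotent_ordering_def bij_betw_def by blast

lemma E_mult: "i \<le> D \<Longrightarrow> j \<le> D \<Longrightarrow> E i ** E j = (if i = j then E i else 0)"
proof -
  assume ij: "i \<le> D" "j \<le> D"
  have "i \<noteq> j \<Longrightarrow> E i \<noteq> E j" using E_inj ij by (auto dest: inj_onD)
  moreover have "E i ** E i = E i"
    using E_primitive[OF ij(1)] unfolding primitive_idempotents_def idempotents_def by blast
  ultimately show ?thesis using primitive_mult_eq_0[OF E_primitive E_primitive] ij by auto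
qed

lemma sum_E_mult:
  assumes "j \<le> D"
  shows "(\<Sum>k\<le>D. c k *\<^sub>R E k) ** E j = c j *\<^sub>R E j"
proof -
  have "(\<Sum>k\<le>D. c k *\<^sub>R E k) ** E j = (\<Sum>k\<le>D. c k *\<^sub>R (E k ** E j))"
    by (rule matrix_sum_scaleR_mult)
  also have "\<dots> = (\<Sum>k\<le>D. if k = j then c j *\<^sub>R E j else 0)"
    using assms by (intro sum.cong refl) (auto simp: E_mult)
  finally show ?thesis using assms by simp
qed

lemma E_coeff_unique:
  assumes "(\<Sum>k\<le>D. c k *\<^sub>R E k) = (\<Sum>k\<le>D. c' k *\<^sub>R E k)" "j \<le> D"
  shows "c j = c' j"
  using sum_E_mult[OF assms(2), of c] sum_E_mult[OF assms(2), of c'] assms E_nonzero by simp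

text \<open>Orthogonality makes the \<open>D + 1\<close> matrices \<open>E k\<close> independent,
  and \<open>dim_BM\<close> leaves no room for anything outside their span.\<close>

lemma E_span:
  assumes "M \<in> BM"
  obtains c where "M = (\<Sum>k\<le>D. c k *\<^sub>R E k)"
proof -
  have ind: "independent (E ` {..D})"
  proof (rule independent_if_scalars_zero)
    fix u F
    assume "(\<Sum>F\<in>E ` {..D}. u F *\<^sub>R F) = 0" and F: "F \<in> E ` {..D}"
    then have *: "(\<Sum>k\<le>D. u (E k) *\<^sub>R E k) = (\<Sum>k\<le>D. 0 *\<^sub>R E k)"
      by (simp add: sum.reindex[OF E_inj])
    have "u (E k) = 0" if "k \<le> D" for k by (rule E_coeff_unique[OF * that])
    then show "u F = 0" using F by auto
  qed simp
  have "card (E ` {..D}) = D + 1" using card_image[OF E_inj] by simp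
  then have "BM \<subseteq> span (E ` {..D})"
    using E_BM dim_BM ind by (intro card_ge_dim_independent) auto
  then have "M \<in> span (E ` {..D})" using assms by blast
  then obtain u where "M = (\<Sum>F\<in>E ` {..D}. u F *\<^sub>R F)" by (auto simp: span_finite)
  then have "M = (\<Sum>k\<le>D. u (E k) *\<^sub>R E k)" by (simp add: sum.reindex[OF E_inj])
  then show thesis by (rule that)
qed

text \<open>Turns the definite description in \<open>krein\<close> into its equation. Uniqueness of
  the coefficient function relies on the prescribed zeros beyond \<open>D\<close> as well as on
  independence.\<close>

lemma krein_eq:
  assumes "i \<le> D" "j \<le> D"
  shows "entrywise_product (E i) (E j) = (1 / real CARD('a)) *\<^sub>R (\<Sum>k\<le>D. krein D E i j k *\<^sub>R E k)"
proof -
  obtain c where "entrywise_product (E i) (E j) = (\<Sum>k\<le>D. c k *\<^sub>R E k)"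
    using E_span[OF BM_entrywise[OF E_BM E_BM]] assms by blast
  then have c: "entrywise_product (E i) (E j) = (1 / real CARD('a)) *\<^sub>R (\<Sum>k\<le>D. (real CARD('a) * c k) *\<^sub>R E k)"
    by (simp add: scaleR_sum_right)
  let ?P = "\<lambda>q. (\<forall>k>D. q k = 0) \<and>
     entrywise_product (E i) (E j) = (1 / real CARD('a)) *\<^sub>R (\<Sum>k\<le>D. q k *\<^sub>R E k)"
  have "\<exists>!q. ?P q"
  proof (rule ex_ex1I)
    have "?P (\<lambda>k. if k \<le> D then real CARD('a) * c k else 0)" using c by simp
    then show "\<exists>q. ?P q" by (rule exI[where x = "\<lambda>k. if k \<le> D then real CARD('a) * c k else 0"])
  next
    fix q q' assume qq: "?P q" "?P q'"
    then have "(1 / real CARD('a)) *\<^sub>R (\<Sum>k\<le>D. q k *\<^sub>R E k) = (1 / real CARD('a)) *\<^sub>R (\<Sum>k\<le>D. q' k *\<^sub>R E k)" by simp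
    then have "(\<Sum>k\<le>D. q k *\<^sub>R E k) = (\<Sum>k\<le>D. q' k *\<^sub>R E k)" by simp
    then have "k \<le> D \<Longrightarrow> q k = q' k" for k by (rule E_coeff_unique)
    moreover have "k > D \<Longrightarrow> q k = q' k" for k using qq by simp
    ultimately show "q = q'" by (metis ext not_le)
  qed
  from theI'[OF this] show ?thesis unfolding krein_def by blast
qed

lemma krein_unique:
  assumes "i \<le> D" "j \<le> D" "k \<le> D"
    and "entrywise_product (E i) (E j) = (1 / real CARD('a)) *\<^sub>R (\<Sum>k\<le>D. c k *\<^sub>R E k)"
  shows "krein D E i j k = c k"
proof (rule E_coeff_unique[OF _ assms(3)])
  have "(1 / real CARD('a)) *\<^sub>R (\<Sum>k\<le>D. krein D E i j k *\<^sub>R E k) = (1 / real CARD('a)) *\<^sub>R (\<Sum>k\<le>D. c k *\<^sub>R E k)"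
    using krein_eq[OF assms(1,2)] assms(4) by simp
  then show "(\<Sum>k\<le>D. krein D E i j k *\<^sub>R E k) = (\<Sum>k\<le>D. c k *\<^sub>R E k)" by simp
qed

lemma krein_entry:
  assumes "i \<le> D" "j \<le> D"
  shows "real CARD('a) * E i $ x $ y * (real CARD('a) * E j $ x $ y) = (\<Sum>k\<le>D. krein D E i j k * (real CARD('a) * E k $ x $ y))"
proof -
  have "entrywise_product (E i) (E j) $ x $ y = (1 / real CARD('a)) * (\<Sum>k\<le>D. krein D E i j k * E k $ x $ y)"
    by (simp add: krein_eq[OF assms])
  then have "real CARD('a) * real CARD('a) * (E i $ x $ y * E j $ x $ y) = real CARD('a) * (\<Sum>k\<le>D. krein D E i j k * E k $ x $ y)"
    by (simp add: entrywise_product_def)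
  then show ?thesis by (simp add: sum_distrib_left mult_ac)
qed

definition trace_E :: "nat \<Rightarrow> real" where "trace_E k = (\<Sum>x\<in>UNIV. E k $ x $ x)"

lemma E_diag_square: "k \<le> D \<Longrightarrow> E k $ x $ x = (\<Sum>y\<in>UNIV. (E k $ x $ y)\<^sup>2)"
proof -
  assume k: "k \<le> D"
  have "(E k ** E k) $ x $ x = (\<Sum>y\<in>UNIV. (E k $ x $ y)\<^sup>2)"
    using E_sym[OF k, of x] by (simp add: matrix_matrix_mult_def power2_eq_square)
  then show ?thesis using E_mult[OF k k] by simp
qed

lemma E_diag_pos: "k \<le> D \<Longrightarrow> 0 < E k $ x $ x"
proof -
  assume k: "k \<le> D"
  have nonneg: "0 \<le> E k $ z $ z" for z by (simp add: E_diag_square[OF k] sum_nonneg)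
  moreover have "E k $ x $ x \<noteq> 0"
  proof
    assume "E k $ x $ x = 0"
    then have "E k $ z $ z = 0" for z using BM_diag[OF E_BM[OF k]] by metis
    then have "E k $ z $ y = 0" for z y
      using E_diag_square[OF k, of z] by (simp add: sum_nonneg_eq_0_iff)
    then have "E k = 0" by (simp add: vec_eq_iff)
    then show False using E_nonzero[OF k] by simp
  qed
  ultimately show ?thesis by (metis less_eq_real_def)
qed

lemma trace_E_pos: "k \<le> D \<Longrightarrow> 0 < trace_E k"
  unfolding trace_E_def by (intro sum_pos E_diag_pos) auto

lemma sum_E_E:
  assumes "j \<le> D" "k \<le> D"
  shows "(\<Sum>x\<in>UNIV. \<Sum>y\<in>UNIV. E j $ x $ y * E k $ x $ y) = (if j = k then trace_E k else 0)"
proof -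
  have "(\<Sum>x\<in>UNIV. \<Sum>y\<in>UNIV. E j $ x $ y * E k $ x $ y) = (\<Sum>x\<in>UNIV. (E j ** E k) $ x $ x)"
    by (intro sum.cong refl) (simp add: matrix_matrix_mult_def E_sym[OF assms(2)])
  then show ?thesis using E_mult[OF assms] by (simp add: trace_E_def)
qed

text \<open>The trace inner product of the Krein expansion with \<open>E k\<close> isolates one
  coefficient. The right-hand side is symmetric in \<open>i\<close>, \<open>j\<close> and
  \<open>k\<close>, which yields \<open>krein_eq_0_sym\<close>.\<close>

lemma krein_trace_E:
  assumes "i \<le> D" "j \<le> D" "k \<le> D"
  shows "krein D E i j k * trace_E k = real CARD('a) * (\<Sum>x\<in>UNIV. \<Sum>y\<in>UNIV. E i $ x $ y * E j $ x $ y * E k $ x $ y)"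
proof -
  have e: "real CARD('a) * (E i $ x $ y * E j $ x $ y) = (\<Sum>l\<le>D. krein D E i j l * E l $ x $ y)" for x y
  proof -
    have "entrywise_product (E i) (E j) $ x $ y = (1 / real CARD('a)) * (\<Sum>l\<le>D. krein D E i j l * E l $ x $ y)"
      by (simp add: krein_eq[OF assms(1,2)])
    then show ?thesis by (simp add: entrywise_product_def)
  qed
  have "real CARD('a) * (\<Sum>x\<in>UNIV. \<Sum>y\<in>UNIV. E i $ x $ y * E j $ x $ y * E k $ x $ y)
      = (\<Sum>x\<in>UNIV. \<Sum>y\<in>UNIV. real CARD('a) * (E i $ x $ y * E j $ x $ y) * E k $ x $ y)"
    by (simp only: sum_distrib_left mult.assoc)
  also have "\<dots> = (\<Sum>x\<in>UNIV. \<Sum>y\<in>UNIV. (\<Sum>l\<le>D. krein D E i j l * E l $ x $ y) * E k $ x $ y)"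
    by (simp only: e)
  also have "\<dots> = (\<Sum>x\<in>UNIV. \<Sum>y\<in>UNIV. \<Sum>l\<le>D. krein D E i j l * (E l $ x $ y * E k $ x $ y))"
    by (simp only: sum_distrib_right mult.assoc)
  also have "\<dots> = (\<Sum>l\<le>D. \<Sum>x\<in>UNIV. \<Sum>y\<in>UNIV. krein D E i j l * (E l $ x $ y * E k $ x $ y))"
    by (subst (2) sum.swap, subst sum.swap) rule
  also have "\<dots> = (\<Sum>l\<le>D. krein D E i j l * (if l = k then trace_E k else 0))"
    using assms by (intro sum.cong refl) (simp add: sum_E_E flip: sum_distrib_left)
  also have "\<dots> = (\<Sum>l\<le>D. if l = k then krein D E i j k * trace_E k else 0)"
    by (intro sum.cong refl) auto
  finally show ?thesis using assms by simp
qed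

lemma krein_eq_0_sym:
  assumes "i \<le> D" "j \<le> D" "k \<le> D" "krein D E i j k = 0"
  shows "krein D E i k j = 0"
proof -
  have "krein D E i k j * trace_E j = krein D E i j k * trace_E k"
    unfolding krein_trace_E[OF assms(1-3)] krein_trace_E[OF assms(1,3,2)] by (simp add: mult_ac)
  then show ?thesis using assms(4) trace_E_pos[OF assms(2)] by simp
qed

lemma sum_E: "(\<Sum>k\<le>D. E k) = mat 1"
proof -
  obtain c where c: "mat 1 = (\<Sum>k\<le>D. c k *\<^sub>R E k)" using E_span[OF BM_mat_1] by blast
  have "c k = 1" if "k \<le> D" for k
    using sum_E_mult[OF that, of c] E_nonzero[OF that] scaleR_cancel_right[of 1 "E k" "c k"]
    by (simp flip: c)
  then show ?thesis by (simp add: c)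
qed

text \<open>The \<open>E j\<close> sum to the identity matrix, so summing the entrywise products
  over \<open>j\<close> leaves the constant diagonal of \<open>E i\<close>. This multiple of the
  identity has equal coefficients at all \<open>E l\<close>.\<close>

lemma sum_krein:
  assumes "i \<le> D" "k \<le> D"
  shows "(\<Sum>j\<le>D. krein D E i j k) = real CARD('a) * E i $ x $ x"
proof -
  have "(\<Sum>l\<le>D. (\<Sum>j\<le>D. krein D E i j l) *\<^sub>R E l) = (\<Sum>l\<le>D. (real CARD('a) * E i $ x $ x) *\<^sub>R E l)"
  proof -
    have "(\<Sum>l\<le>D. (\<Sum>j\<le>D. krein D E i j l) *\<^sub>R E l) = (\<Sum>j\<le>D. \<Sum>l\<le>D. krein D E i j l *\<^sub>R E l)"
      unfolding scaleR_sum_left by (rule sum.swap)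
    also have "\<dots> = (\<Sum>j\<le>D. real CARD('a) *\<^sub>R entrywise_product (E i) (E j))"
      by (simp add: krein_eq[OF assms(1)])
    also have "\<dots> = real CARD('a) *\<^sub>R entrywise_product (E i) (\<Sum>j\<le>D. E j)"
      by (simp add: vec_eq_iff entrywise_product_def sum_distrib_left)
    also have "\<dots> = (real CARD('a) * E i $ x $ x) *\<^sub>R mat 1"
      unfolding sum_E using BM_diag[OF E_BM[OF assms(1)], of _ x]
      by (simp add: vec_eq_iff entrywise_product_def mat_def)
    also have "\<dots> = (\<Sum>l\<le>D. (real CARD('a) * E i $ x $ x) *\<^sub>R E l)"
      by (simp flip: sum_E scaleR_sum_right)
    finally show ?thesis .
  qed
  then show ?thesis by (rule E_coeff_unique[OF _ assms(2)])
qed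

lemma krein_0:
  assumes "i \<le> D" "k \<le> D"
  shows "krein D E i 0 k = of_bool (k = i)"
proof (rule krein_unique[OF assms(1) _ assms(2)])
  have "(\<Sum>k\<le>D. of_bool (k = i) *\<^sub>R E k) = (\<Sum>k\<le>D. if k = i then E k else 0)"
    by (intro sum.cong refl) simp
  then have "(\<Sum>k\<le>D. of_bool (k = i) *\<^sub>R E k) = E i" using assms by simp
  then show "entrywise_product (E i) (E 0) = (1 / real CARD('a)) *\<^sub>R (\<Sum>k\<le>D. of_bool (k = i) *\<^sub>R E k)"
    by (simp add: vec_eq_iff entrywise_product_def E_0)
qed simp

end

section \<open>Q-polynomial orderings: tridiagonal Krein matrices and separation of
  relations\<close>

locale Q_polynomial_scheme = ordered_scheme D R E
  for D and R :: "nat \<Rightarrow> 'a::finite rel" and E +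
  assumes Q_poly: "Q_polynomial D E" and D_pos: "1 \<le> D"
begin

text \<open>The matrices \<open>E 0\<close> to \<open>E i\<close> come from polynomials of every
  degree up to \<open>i\<close>, so the leading term can be subtracted in an induction on
  \<open>i\<close>.\<close>

lemma poly_in_span:
  assumes "degree p \<le> i" "i \<le> D"
  shows "\<exists>c. (\<forall>k. i < k \<longrightarrow> c k = 0) \<and>
    (\<forall>x y. poly p (real CARD('a) * E 1 $ x $ y) = (\<Sum>k\<le>D. c k * (real CARD('a) * E k $ x $ y)))"
  using assms
proof (induction i arbitrary: p)
  case 0
  then have "degree p = 0" by simp
  then obtain a where "p = [:a:]" by (rule degree_eq_zeroE)
  moreover have "(\<Sum>k\<le>D. (if k = 0 then a else 0) * (real CARD('a) * E k $ x $ y)) = (\<Sum>k\<le>D. if k = 0 then a else 0)" for x y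
    by (intro sum.cong refl) (simp add: E_0)
  ultimately show ?case by (intro exI[of _ "\<lambda>k. if k = 0 then a else 0"]) simp
next
  case (Suc i)
  obtain v where v: "degree v = Suc i" "\<And>x y. real CARD('a) * E (Suc i) $ x $ y = poly v (real CARD('a) * E 1 $ x $ y)"
    using Q_poly Suc.prems(2) unfolding Q_polynomial_def by blast
  define a where "a = coeff p (Suc i) / coeff v (Suc i)"
  have lead: "coeff v (Suc i) \<noteq> 0" using v(1) by (metis leading_coeff_0_iff degree_0 nat.distinct(1))
  have "degree (p - smult a v) \<le> i"
  proof (rule degree_le, intro allI impI)
    fix m assume "i < m"
    then consider "m = Suc i" | "Suc i < m" by linarith
    then show "coeff (p - smult a v) m = 0"
      using lead v(1) Suc.prems(1) by cases (auto simp: a_def coeff_eq_0)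
  qed
  then obtain c where c: "\<And>k. i < k \<Longrightarrow> c k = 0"
      "\<And>x y. poly (p - smult a v) (real CARD('a) * E 1 $ x $ y) = (\<Sum>k\<le>D. c k * (real CARD('a) * E k $ x $ y))"
    using Suc.IH[of "p - smult a v"] Suc.prems(2) by auto
  have "poly p (real CARD('a) * E 1 $ x $ y) = (\<Sum>k\<le>D. (c k + (if k = Suc i then a else 0)) * (real CARD('a) * E k $ x $ y))" for x y
  proof -
    have "(\<Sum>k\<le>D. (if k = Suc i then a else 0) * (real CARD('a) * E k $ x $ y))
        = (\<Sum>k\<le>D. if k = Suc i then a * (real CARD('a) * E k $ x $ y) else 0)"
      by (intro sum.cong refl) simp
    also have "\<dots> = a * poly v (real CARD('a) * E 1 $ x $ y)" using Suc.prems(2) by (simp add: v)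
    finally show ?thesis using c(2)[of x y] by (simp add: distrib_right sum.distrib)
  qed
  then show ?case using c(1) by (intro exI[of _ "\<lambda>k. c k + (if k = Suc i then a else 0)"]) auto
qed

text \<open>If \<open>j + 1 < k\<close>, the entrywise product of \<open>E 1\<close> and
  \<open>E j\<close> is a polynomial of degree at most \<open>j + 1\<close> in \<open>E 1\<close>
  and has no component at \<open>k\<close>. If \<open>k + 1 < j\<close>, the trace symmetry
  exchanges \<open>j\<close> and \<open>k\<close>.\<close>

lemma krein_eq_0:
  assumes "j \<le> D" "k \<le> D" "k \<noteq> j" "k \<noteq> j + 1" "j \<noteq> k + 1"
  shows "krein D E 1 j k = 0"
proof -
  have *: "krein D E 1 j k = 0" if "j + 1 < k" "k \<le> D" for j k
  proof -
    have "j \<le> D" using that by simp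
    then obtain v where v: "degree v = j" "\<And>x y. real CARD('a) * E j $ x $ y = poly v (real CARD('a) * E 1 $ x $ y)"
      using Q_poly \<open>j \<le> D\<close> unfolding Q_polynomial_def by blast
    have "j + 1 \<le> D" using that by simp
    moreover have "degree ([:0, 1:] * v) \<le> j + 1"
      using degree_mult_le[of "[:0, 1:]" v] v(1) by simp
    ultimately obtain c where c: "\<And>k. j + 1 < k \<Longrightarrow> c k = 0"
      "\<And>x y. poly ([:0, 1:] * v) (real CARD('a) * E 1 $ x $ y) = (\<Sum>k\<le>D. c k * (real CARD('a) * E k $ x $ y))"
      using poly_in_span[of "[:0, 1:] * v" "j + 1"] by blast
    have "entrywise_product (E 1) (E j) = (1 / real CARD('a)) *\<^sub>R (\<Sum>k\<le>D. c k *\<^sub>R E k)"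
    proof -
      have "E 1 $ x $ y * E j $ x $ y = 1 / real CARD('a) * (\<Sum>k\<le>D. c k * E k $ x $ y)" for x y
      proof -
        have "real CARD('a) * E 1 $ x $ y * (real CARD('a) * E j $ x $ y) = (\<Sum>k\<le>D. c k * (real CARD('a) * E k $ x $ y))"
          using c(2)[of x y] v(2) by simp
        also have "\<dots> = real CARD('a) * (\<Sum>k\<le>D. c k * E k $ x $ y)" by (simp add: sum_distrib_left mult_ac)
        finally show ?thesis by (simp add: field_simps)
      qed
      then show ?thesis by (simp add: vec_eq_iff entrywise_product_def)
    qed
    then have "krein D E 1 j k = c k" using D_pos that by (intro krein_unique) auto
    then show ?thesis using c(1) that by simp
  qed
  consider "j + 1 < k" | "k + 1 < j" using assms by linarith
  then show ?thesis
    using * assms krein_eq_0_sym[of 1 k j] D_pos by cases auto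
qed

text \<open>Every \<open>E k\<close> is a function of the entry of \<open>E 1\<close>, and the
  adjacency matrix of \<open>R i\<close> is a combination of the \<open>E k\<close>; so it cannot
  distinguish pairs with equal entries of \<open>E 1\<close>.\<close>

lemma E_1_distinct:
  assumes "i \<le> D" "j \<le> D" "(x, y) \<in> R i" "(x', y') \<in> R j" "E 1 $ x $ y = E 1 $ x' $ y'"
  shows "i = j"
proof (rule ccontr)
  assume "i \<noteq> j"
  have "E k $ x $ y = E k $ x' $ y'" if "k \<le> D" for k
  proof -
    obtain v where "\<And>x y. real CARD('a) * E k $ x $ y = poly v (real CARD('a) * E 1 $ x $ y)"
      using Q_poly \<open>k \<le> D\<close> unfolding Q_polynomial_def by blast
    then have "real CARD('a) * E k $ x $ y = real CARD('a) * E k $ x' $ y'" using assms(5) by simp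
    then show ?thesis by simp
  qed
  moreover have "adjacency_matrix (R i) \<in> BM"
    unfolding bose_mesner_def using assms(1) by (auto intro: span_base)
  then obtain c where "adjacency_matrix (R i) = (\<Sum>k\<le>D. c k *\<^sub>R E k)" by (rule E_span)
  ultimately have "adjacency_matrix (R i) $ x $ y = adjacency_matrix (R i) $ x' $ y'" by simp
  then show False
    using assms rel_unique[of x' y' i j] \<open>i \<noteq> j\<close> by (simp add: adjacency_matrix_def split: if_splits)
qed

end

section \<open>Mutually unbiased bases\<close>

lemma sum_UNIV_split: "sum g (UNIV :: 'a::finite set) = sum g A + sum g (- A)"
  using sum.union_disjoint[of A "- A" g] by (simp add: Compl_partition)

text \<open>Unbiased bases and their negatives, described by their Gram matrix \<open>t\<close>. By
  \<open>t_conv\<close>, \<open>t\<close> divided by \<open>\<kappa>\<close> is a projection;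
  \<open>s\<close> stands for \<open>1 / sqrt d\<close>, so that \<open>\<kappa>\<close> is the
  tight frame constant \<open>|X| / d\<close>.\<close>

locale mub_gram =
  fixes t :: "'a::finite \<Rightarrow> 'a \<Rightarrow> real" and s :: real and \<kappa> :: real
  assumes t_sym: "t x y = t y x"
    and t_refl: "t x x = 1"
    and t_eq_1: "t x y = 1 \<Longrightarrow> x = y"
    and t_conv: "(\<Sum>z\<in>UNIV. t x z * t z y) = \<kappa> * t x y"
    and gram_const_def: "\<kappa> = real CARD('a) * s\<^sup>2"
    and t_values: "t x y \<in> {1, s, 0, -s, -1}"
    and s_pos: "0 < s" and s_less_1: "s < 1"
    and ex_antipode: "\<exists>y. t x y = -1"
    and same_class_trans: "\<bar>t x y\<bar> \<noteq> s \<Longrightarrow> \<bar>t y z\<bar> \<noteq> s \<Longrightarrow> \<bar>t x z\<bar> \<noteq> s"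
begin

lemma gram_const_pos: "0 < \<kappa>"
  using s_pos unfolding gram_const_def by simp

lemma t_conv': "(\<Sum>z\<in>UNIV. t z x * t z y) = \<kappa> * t x y"
  using t_conv[of x y] by (simp add: t_sym[of _ x])

text \<open>The columns of \<open>t\<close> with this scaling have Gram matrix \<open>t\<close>, as
  \<open>t\<close> squares to \<open>\<kappa>\<close> times itself. Linear relations between points
  can then be proved by showing that a vector has norm zero.\<close>

definition vec_of :: "'a \<Rightarrow> real^'a" where
  "vec_of x = (\<chi> z. t z x / sqrt \<kappa>)"

lemma vec_of_inner: "vec_of x \<bullet> vec_of y = t x y"
proof -
  have "vec_of x \<bullet> vec_of y = (\<Sum>z\<in>UNIV. t z x * t z y) / \<kappa>"
    using gram_const_pos by (simp add: vec_of_def inner_vec_def sum_divide_distrib)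
  then show ?thesis using gram_const_pos by (simp add: t_conv')
qed

definition antipode :: "'a \<Rightarrow> 'a" where "antipode x = (SOME y. t x y = -1)"

lemma t_antipode_self: "t x (antipode x) = -1"
  unfolding antipode_def by (rule someI_ex[OF ex_antipode])

lemma t_antipode: "t (antipode x) y = - t x y"
proof -
  have "(vec_of x + vec_of (antipode x)) \<bullet> (vec_of x + vec_of (antipode x)) = 0"
    by (simp add: inner_add vec_of_inner t_refl t_antipode_self t_sym[of "antipode x" x])
  then have "vec_of x + vec_of (antipode x) = 0" by simp
  then have "(vec_of x + vec_of (antipode x)) \<bullet> vec_of y = 0" by simp
  then show ?thesis by (simp add: inner_add vec_of_inner)
qed

lemma t_antipode': "t y (antipode x) = - t y x"
  using t_antipode[of x y] by (simp add: t_sym)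

lemma antipode_antipode: "antipode (antipode x) = x"
  by (rule t_eq_1) (simp add: t_antipode t_refl)

lemma antipode_neq: "antipode x \<noteq> x"
  using t_antipode_self[of x] t_refl[of x] by auto

lemma t_eq_minus_1: "t x y = -1 \<longleftrightarrow> y = antipode x"
proof
  assume "t x y = -1"
  then have "t (antipode x) y = 1" by (simp add: t_antipode)
  then show "y = antipode x" using t_eq_1 by blast
qed (simp add: t_antipode_self)

lemma t_eq_1_iff: "t x y = 1 \<longleftrightarrow> y = x"
  using t_eq_1 t_refl by auto

text \<open>Inner products of vectors from different bases are \<open>\<plusminus>s\<close>, those within a basis are not.\<close>

definition cls :: "'a \<Rightarrow> 'a set" where "cls w = {z. \<bar>t w z\<bar> \<noteq> s}"

lemma self_in_cls: "x \<in> cls x"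
  using s_less_1 by (simp add: cls_def t_refl)

lemma cls_sym: "x \<in> cls y \<longleftrightarrow> y \<in> cls x"
  by (simp add: cls_def t_sym)

lemma cls_eq: "x \<in> cls y \<Longrightarrow> cls x = cls y"
  using same_class_trans[of y x] same_class_trans[of x y] by (auto simp: cls_def t_sym[of x y])

lemma antipode_in_cls: "antipode x \<in> cls w \<longleftrightarrow> x \<in> cls w"
  by (simp add: cls_def t_antipode')

lemma t_in_cls: "z \<in> cls x \<Longrightarrow> z \<noteq> x \<Longrightarrow> z \<noteq> antipode x \<Longrightarrow> t x z = 0"
  using t_values[of x z] t_eq_1[of x z] t_eq_minus_1[of x z] s_pos by (auto simp: cls_def)

lemma t_notin_cls: "z \<notin> cls x \<Longrightarrow> (t x z)\<^sup>2 = s\<^sup>2"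
  by (simp add: cls_def) (metis power2_abs)

lemma sum_cls_t:
  "(\<Sum>z\<in>cls x. t x z * g z) = g x - g (antipode x)"
proof -
  have "(\<Sum>z\<in>cls x. t x z * g z) = (\<Sum>z\<in>{x, antipode x}. t x z * g z)"
    using t_in_cls by (intro sum.mono_neutral_right) (auto simp: self_in_cls antipode_in_cls)
  also have "\<dots> = g x - g (antipode x)"
    using antipode_neq[of x] by (simp add: t_refl t_antipode_self)
  finally show ?thesis .
qed

text \<open>The squared inner products with \<open>x\<close> sum to \<open>|X|\<close> times
  \<open>s\<^sup>2\<close> over all points and to 2 over the class, while each point outside
  contributes \<open>s\<^sup>2\<close>.\<close>

lemma card_cls: "real (card (cls x)) * s\<^sup>2 = 2"
proof -
  have "(\<Sum>z\<in>UNIV. t x z * t x z) = (\<Sum>z\<in>cls x. t x z * t x z) + (\<Sum>z\<in>-cls x. t x z * t x z)"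
    by (rule sum_UNIV_split)
  moreover have "(\<Sum>z\<in>cls x. t x z * t x z) = 2"
    by (simp add: sum_cls_t t_refl t_antipode_self)
  moreover have "(\<Sum>z\<in>-cls x. t x z * t x z) = (\<Sum>z\<in>-cls x. s\<^sup>2)"
    by (intro sum.cong refl) (simp add: t_notin_cls flip: power2_eq_square)
  moreover have "(\<Sum>z\<in>UNIV. t x z * t x z) = real CARD('a) * s\<^sup>2"
    using t_conv[of x x] by (simp add: t_refl t_sym gram_const_def)
  moreover have "real (card (- cls x)) = real CARD('a) - real (card (cls x))"
    using sum_UNIV_split[of "\<lambda>_. 1 :: real" "cls x"] by simp
  ultimately show ?thesis by (simp add: algebra_simps)
qed

lemma sum_cls_square: "(\<Sum>z\<in>cls w. (t y z)\<^sup>2) = 2"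
proof (cases "y \<in> cls w")
  case True
  then show ?thesis
    using sum_cls_t[of y "t y"] by (simp add: cls_eq power2_eq_square t_refl t_antipode_self)
next
  case False
  have "(\<Sum>z\<in>cls w. (t y z)\<^sup>2) = (\<Sum>z\<in>cls w. s\<^sup>2)"
  proof (intro sum.cong refl t_notin_cls notI)
    fix z assume "z \<in> cls w" "z \<in> cls y"
    then have "cls y = cls w" using cls_eq by metis
    then show False using False self_in_cls by auto
  qed
  then show ?thesis using card_cls[of w] by simp
qed

text \<open>The vectors of a class are plus and minus an orthonormal basis of the whole space: the
  defect of the expansion of \<open>vec_of y\<close> has length zero.\<close>

lemma sum_cls: "(\<Sum>z\<in>cls w. t z x * t z y) = 2 * t x y"
proof -
  define p where "p = (\<Sum>z\<in>cls w. t y z *\<^sub>R vec_of z)"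
  have py: "p \<bullet> vec_of u = (\<Sum>z\<in>cls w. t y z * t z u)" for u
    by (simp add: p_def inner_sum_left vec_of_inner)
  have "p \<bullet> p = (\<Sum>z\<in>cls w. t y z * (\<Sum>z'\<in>cls w. t z z' * t y z'))"
    by (simp add: p_def inner_sum_left inner_sum_right vec_of_inner sum_distrib_left mult_ac t_sym)
  also have "\<dots> = (\<Sum>z\<in>cls w. t y z * (2 * t y z))"
  proof (intro sum.cong refl arg_cong2[of _ _ _ _ times])
    fix z assume "z \<in> cls w"
    then show "(\<Sum>z'\<in>cls w. t z z' * t y z') = 2 * t y z"
      using sum_cls_t[of z "t y"] by (simp add: cls_eq t_antipode')
  qed
  also have "\<dots> = 2 * (\<Sum>z\<in>cls w. (t y z)\<^sup>2)"
    by (simp add: sum_distrib_left power2_eq_square mult_ac)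
  finally have pp: "p \<bullet> p = 4" by (simp add: sum_cls_square)
  have "p \<bullet> vec_of y = (\<Sum>z\<in>cls w. (t y z)\<^sup>2)"
    by (simp add: py power2_eq_square t_sym)
  then have "p \<bullet> vec_of y = 2" by (simp add: sum_cls_square)
  then have "(p - 2 *\<^sub>R vec_of y) \<bullet> (p - 2 *\<^sub>R vec_of y) = 0"
    using pp by (simp add: inner_diff inner_commute[of "vec_of y" p] vec_of_inner t_refl)
  then have "p = 2 *\<^sub>R vec_of y" by simp
  then have "p \<bullet> vec_of x = 2 * t y x" by (simp add: vec_of_inner)
  then show ?thesis using py[of x] by (simp add: t_sym mult.commute)
qed

section \<open>Fourth moments and the design property\<close>

definition moment :: "'a \<Rightarrow> 'a \<Rightarrow> 'a \<Rightarrow> 'a \<Rightarrow> real" where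
  "moment x y z w = (\<Sum>u\<in>UNIV. t u x * t u y * t u z * t u w)"

definition excess :: real ("\<gamma>") where "\<gamma> = (\<kappa> - 2) * s\<^sup>2"

text \<open>Inside \<open>cls x\<close> only \<open>x\<close> and its antipode contribute. Outside
  it the factor \<open>(t u x)\<^sup>2\<close> is \<open>s\<^sup>2\<close> and the remaining sum has
  frame constant \<open>\<kappa> - 2\<close> by \<open>sum_cls\<close>; the product of the two is
  \<open>\<gamma>\<close>.\<close>

lemma moment_diag: "moment x x z w = \<gamma> * t z w + 2 * (t x z * t x w)"
proof -
  have "moment x x z w = (\<Sum>u\<in>cls x. t u x * t u x * t u z * t u w)
      + (\<Sum>u\<in>-cls x. t u x * t u x * t u z * t u w)"
    unfolding moment_def by (rule sum_UNIV_split)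
  moreover have "(\<Sum>u\<in>cls x. t u x * t u x * t u z * t u w) = 2 * (t x z * t x w)"
    using sum_cls_t[of x "\<lambda>u. t u x * t u z * t u w"]
    by (simp add: t_refl t_antipode t_antipode_self t_sym[of _ x] mult_ac)
  moreover have "(\<Sum>u\<in>-cls x. t u x * t u x * t u z * t u w) = \<gamma> * t z w"
  proof -
    have "(\<Sum>u\<in>-cls x. t u x * t u x * t u z * t u w) = (\<Sum>u\<in>-cls x. s\<^sup>2 * (t u z * t u w))"
    proof (intro sum.cong refl)
      fix u assume "u \<in> - cls x"
      then have "t u x * t u x = s\<^sup>2"
        using t_notin_cls[of u x] by (simp add: t_sym power2_eq_square)
      then show "t u x * t u x * t u z * t u w = s\<^sup>2 * (t u z * t u w)" by simp
    qed
    also have "\<dots> = s\<^sup>2 * (\<Sum>u\<in>-cls x. t u z * t u w)" by (simp add: sum_distrib_left)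
    also have "(\<Sum>u\<in>-cls x. t u z * t u w) = (\<Sum>u\<in>UNIV. t u z * t u w) - (\<Sum>u\<in>cls x. t u z * t u w)"
      by (simp add: Compl_eq_Diff_UNIV sum_diff)
    finally show ?thesis by (simp only: t_conv' sum_cls excess_def) (simp add: algebra_simps)
  qed
  ultimately show ?thesis by simp
qed

text \<open>Stated for any tight frame \<open>A\<close>, because it is applied both to all points,
  with \<open>r = \<kappa>\<close>, and to one class, with \<open>r = 2\<close>. For the squares,
  expanding one factor and applying the first identity leaves moments with a repeated point, known
  from \<open>moment_diag\<close>.\<close>

lemma double_sum_moment:
  assumes frame: "\<And>x y. (\<Sum>z\<in>A. t z x * t z y) = r * t x y"
  shows "(\<Sum>z\<in>A. \<Sum>w\<in>A. moment x y z w * (t z p * t w q)) = r\<^sup>2 * moment x y p q" (is ?cross)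
    and "(\<Sum>z\<in>A. \<Sum>w\<in>A. (moment x y z w)\<^sup>2)
      = r\<^sup>2 * (\<gamma> * \<kappa> * (t x y)\<^sup>2 + 2 * \<gamma> + 4 * (t x y)\<^sup>2)" (is ?square)
proof -
  have 1: "(\<Sum>z\<in>A. \<Sum>w\<in>A. moment x y z w * (t z p * t w q)) = r\<^sup>2 * moment x y p q" for p q
  proof -
    have "(\<Sum>z\<in>A. \<Sum>w\<in>A. moment x y z w * (t z p * t w q))
        = (\<Sum>z\<in>A. \<Sum>w\<in>A. \<Sum>u\<in>UNIV. t u x * t u y * (t z u * t z p) * (t w u * t w q))"
      by (simp add: moment_def sum_distrib_left sum_distrib_right mult_ac t_sym)
    also have "\<dots> = (\<Sum>u\<in>UNIV. \<Sum>z\<in>A. \<Sum>w\<in>A. t u x * t u y * (t z u * t z p) * (t w u * t w q))"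
      by (subst (2) sum.swap, subst sum.swap) rule
    also have "\<dots> = (\<Sum>u\<in>UNIV. t u x * t u y * (\<Sum>z\<in>A. t z u * t z p) * (\<Sum>w\<in>A. t w u * t w q))"
      by (simp add: sum_distrib_left sum_distrib_right mult_ac)
    also have "\<dots> = (\<Sum>u\<in>UNIV. r\<^sup>2 * (t u x * t u y * t u p * t u q))"
      by (simp add: frame power2_eq_square mult_ac)
    finally show ?thesis by (simp add: moment_def sum_distrib_left)
  qed
  show ?cross by (rule 1)
  have "(\<Sum>z\<in>A. \<Sum>w\<in>A. (moment x y z w)\<^sup>2)
      = (\<Sum>z\<in>A. \<Sum>w\<in>A. \<Sum>u\<in>UNIV. t u x * t u y * (moment x y z w * (t z u * t w u)))"
    by (simp add: power2_eq_square moment_def[of _ _ _ _] sum_distrib_left mult_ac t_sym)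
  also have "\<dots> = (\<Sum>u\<in>UNIV. \<Sum>z\<in>A. \<Sum>w\<in>A. t u x * t u y * (moment x y z w * (t z u * t w u)))"
    by (subst (2) sum.swap, subst sum.swap) rule
  also have "\<dots> = (\<Sum>u\<in>UNIV. t u x * t u y * (r\<^sup>2 * moment x y u u))"
    by (simp add: sum_distrib_left flip: 1)
  also have "\<dots> = (\<Sum>u\<in>UNIV. r\<^sup>2 * (\<gamma> * t x y * (t u x * t u y) + 2 * (t u x * t u x * t u y * t u y)))"
  proof (intro sum.cong refl)
    fix u
    have "moment x y u u = \<gamma> * t x y + 2 * (t u x * t u y)"
      using moment_diag[of u x y] by (simp add: moment_def mult_ac)
    then show "t u x * t u y * (r\<^sup>2 * moment x y u u)
        = r\<^sup>2 * (\<gamma> * t x y * (t u x * t u y) + 2 * (t u x * t u x * t u y * t u y))"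
      by (simp add: algebra_simps)
  qed
  also have "\<dots> = r\<^sup>2 * (\<gamma> * t x y * (\<kappa> * t x y) + 2 * moment x x y y)"
    by (simp add: sum_distrib_left[symmetric] sum.distrib t_conv' moment_def)
  finally show ?square
    by (simp add: moment_diag t_refl power2_eq_square algebra_simps)
qed

lemma frame_pairings:
  assumes frame: "\<And>x y. (\<Sum>z\<in>A. t z x * t z y) = r * t x y"
  shows "(\<Sum>z\<in>A. \<Sum>w\<in>A. (t z a * t w b) * (t z c * t w d)) = r\<^sup>2 * (t a c * t b d)"
proof -
  have "(\<Sum>z\<in>A. \<Sum>w\<in>A. (t z a * t w b) * (t z c * t w d))
      = (\<Sum>z\<in>A. t z a * t z c) * (\<Sum>w\<in>A. t w b * t w d)"
    by (simp add: sum_product mult_ac)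
  then show ?thesis by (simp add: frame power2_eq_square)
qed

text \<open>For \<open>\<gamma> = 1\<close> the points form a spherical 5-design: the difference of the fourth moment and
  its value for a design has norm zero.\<close>

lemma moment_eq:
  assumes "\<gamma> = 1"
  shows "moment x y z w = t x y * t z w + t x z * t y w + t x w * t y z"
proof -
  define h where "h z w = t z x * t w y + t z y * t w x" for z w
  define D where "D z w = moment x y z w - t x y * t z w - h z w" for z w
  \<comment> \<open>In terms of \<open>d = 1 / s\<^sup>2\<close> the assumption reads
    \<open>\<kappa> = d + 2\<close>, and \<open>|X| = \<kappa> * d\<close> gives the number of
    points below.\<close>
  have k: "\<kappa> * s\<^sup>2 = 1 + 2 * s\<^sup>2"
    using assms by (simp add: excess_def algebra_simps)
  have n: "real CARD('a) = \<kappa> * (\<kappa> - 2)"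
  proof -
    have "s\<^sup>2 * real CARD('a) = s\<^sup>2 * (\<kappa> * (\<kappa> - 2))"
      using k by (simp add: algebra_simps gram_const_def)
    then show ?thesis using s_pos by simp
  qed
  have fr: "(\<Sum>z\<in>UNIV. t z x * t z y) = \<kappa> * t x y" for x y by (rule t_conv')
  note cross = double_sum_moment(1)[OF fr] and pair = frame_pairings[OF fr]
  have tt: "(\<Sum>z\<in>UNIV. \<Sum>w\<in>UNIV. (t z p * t w q) * t z w) = \<kappa>\<^sup>2 * t p q" for p q
  proof -
    have "(\<Sum>z\<in>UNIV. \<Sum>w\<in>UNIV. (t z p * t w q) * t z w) = (\<Sum>z\<in>UNIV. t z p * (\<Sum>w\<in>UNIV. t w q * t w z))"
      by (simp add: sum_distrib_left mult_ac t_sym)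
    also have "\<dots> = (\<Sum>z\<in>UNIV. \<kappa> * (t z p * t z q))"
      unfolding t_conv' by (simp add: mult_ac t_sym)
    also have "\<dots> = \<kappa> * (\<Sum>z\<in>UNIV. t z p * t z q)" by (rule sum_distrib_left[symmetric])
    finally show ?thesis by (simp add: t_conv' power2_eq_square)
  qed
  have sq: "(\<Sum>z\<in>UNIV. \<Sum>w\<in>UNIV. (t z w)\<^sup>2) = \<kappa>\<^sup>2 * (\<kappa> - 2)"
  proof -
    have "(\<Sum>z\<in>UNIV. \<Sum>w\<in>UNIV. (t z w)\<^sup>2) = (\<Sum>z\<in>UNIV. \<kappa> * t z z)"
      by (simp add: t_conv'[symmetric] power2_eq_square t_sym)
    then show ?thesis by (simp add: t_refl n power2_eq_square)
  qed
  have mt: "(\<Sum>z\<in>UNIV. \<Sum>w\<in>UNIV. moment x y z w * t z w) = \<kappa>^3 * t x y"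
  proof -
    have "(\<Sum>z\<in>UNIV. \<Sum>w\<in>UNIV. moment x y z w * t z w)
      = (\<Sum>z\<in>UNIV. \<Sum>w\<in>UNIV. \<Sum>u\<in>UNIV. t u x * t u y * ((t z u * t w u) * t z w))"
      by (simp add: moment_def sum_distrib_left sum_distrib_right mult_ac t_sym)
    also have "\<dots> = (\<Sum>u\<in>UNIV. \<Sum>z\<in>UNIV. \<Sum>w\<in>UNIV. t u x * t u y * ((t z u * t w u) * t z w))"
      by (subst (2) sum.swap, subst sum.swap) rule
    also have "\<dots> = (\<Sum>u\<in>UNIV. t u x * t u y * \<kappa>\<^sup>2)"
      by (simp add: tt t_refl flip: sum_distrib_left)
    finally show ?thesis by (simp add: t_conv' power2_eq_square power3_eq_cube flip: sum_distrib_right)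
  qed
  have mh: "(\<Sum>z\<in>UNIV. \<Sum>w\<in>UNIV. moment x y z w * h z w) = 2 * \<kappa>\<^sup>2 * (1 + 2 * (t x y)\<^sup>2)"
  proof -
    have "moment x y x y = 1 + 2 * (t x y)\<^sup>2" "moment x y y x = 1 + 2 * (t x y)\<^sup>2"
      using moment_diag[of x y y] assms
      by (simp_all add: moment_def mult_ac t_refl power2_eq_square)
    then show ?thesis
      by (simp add: h_def distrib_left sum.distrib cross)
  qed
  have hh: "(\<Sum>z\<in>UNIV. \<Sum>w\<in>UNIV. h z w * h z w) = 2 * \<kappa>\<^sup>2 * (1 + (t x y)\<^sup>2)"
    unfolding h_def distrib_left distrib_right sum.distrib pair
    by (simp add: t_refl t_sym[of y x] power2_eq_square algebra_simps)
  have ht: "(\<Sum>z\<in>UNIV. \<Sum>w\<in>UNIV. h z w * t z w) = 2 * \<kappa>\<^sup>2 * t x y"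
    by (simp add: h_def distrib_right sum.distrib tt t_sym[of y x])
  \<comment> \<open>The square expands into six sums, each evaluated above or by
    \<open>double_sum_moment\<close>; all have the factor \<open>\<kappa>\<^sup>2\<close>, and the
    coefficients cancel.\<close>
  have "(\<Sum>z\<in>UNIV. \<Sum>w\<in>UNIV. (D z w)\<^sup>2)
     = (\<Sum>z\<in>UNIV. \<Sum>w\<in>UNIV. (moment x y z w)\<^sup>2 + (t x y)\<^sup>2 * (t z w)\<^sup>2 + h z w * h z w
        - 2 * t x y * (moment x y z w * t z w) - 2 * (moment x y z w * h z w) + 2 * t x y * (h z w * t z w))"
    by (intro sum.cong refl) (simp add: D_def power2_eq_square algebra_simps)
  also have "\<dots> = \<kappa>\<^sup>2 * (\<kappa> * (t x y)\<^sup>2 + 2 + 4 * (t x y)\<^sup>2) + (t x y)\<^sup>2 * (\<kappa>\<^sup>2 * (\<kappa> - 2))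
      + 2 * \<kappa>\<^sup>2 * (1 + (t x y)\<^sup>2) - 2 * t x y * (\<kappa>^3 * t x y) - 2 * (2 * \<kappa>\<^sup>2 * (1 + 2 * (t x y)\<^sup>2))
      + 2 * t x y * (2 * \<kappa>\<^sup>2 * t x y)"
    using double_sum_moment(2)[OF fr, of x y] assms
    by (simp add: sum.distrib sum_subtractf flip: sum_distrib_left) (simp add: sq mt mh hh ht)
  also have "\<dots> = 0"
    by (simp add: power2_eq_square power3_eq_cube algebra_simps)
  finally have "(\<Sum>z\<in>UNIV. \<Sum>w\<in>UNIV. (D z w)\<^sup>2) = 0" .
  then have "D z w = 0"
    by (simp add: sum_nonneg_eq_0_iff sum_nonneg)
  then show ?thesis by (simp add: D_def h_def t_sym[of z x] t_sym[of z y] t_sym[of w x] t_sym[of w y] algebra_simps)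
qed

section \<open>Quadruple regularity in terms of inner products, and its consequence for
  \<open>\<gamma>\<close>\<close>

definition congruent4 :: "(nat \<Rightarrow> 'a) \<Rightarrow> (nat \<Rightarrow> 'a) \<Rightarrow> bool" where
  "congruent4 x y \<longleftrightarrow> (\<forall>k\<in>{1..4}. \<forall>l\<in>{1..4}. t (x k) (x l) = t (y k) (y l))"

text \<open>Equality of counts for congruent quadruples replaces the existence of a common count.
  \<open>\<beta>\<close> may take arbitrary real values, since unattained ones give empty sets on
  both sides.\<close>

definition regular4 :: bool where
  "regular4 \<longleftrightarrow> (\<forall>x y \<beta>. congruent4 x y \<longrightarrow>
     card {z. \<forall>k\<in>{1..4}. t (x k) z = \<beta> k} = card {z. \<forall>k\<in>{1..4}. t (y k) z = \<beta> k})"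

lemma prod4: "(\<Prod>k\<in>{1..4::nat}. g k) = g 1 * g 2 * g 3 * (g 4 :: real)"
proof -
  have "{1..4::nat} = {1, 2, 3, 4}" by auto
  then show ?thesis by (simp add: mult_ac)
qed

text \<open>Grouping \<open>z\<close> by its four inner products makes the sum a combination of the
  counts in \<open>regular4\<close>, with the same coefficients for \<open>x\<close> and
  \<open>y\<close>.\<close>

lemma sum_prod_congruent:
  assumes regular4 "congruent4 x y"
  shows "(\<Sum>z\<in>UNIV. \<Prod>k\<in>{1..4}. t (x k) z) = (\<Sum>z\<in>UNIV. \<Prod>k\<in>{1..4}. t (y k) z)"
proof -
  define P where "P = ({1..4::nat} \<rightarrow>\<^sub>E {1, s, 0, -s, -1})"
  have *: "(\<Sum>z\<in>UNIV. \<Prod>k\<in>{1..4}. t (x k) z)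
      = (\<Sum>\<beta>\<in>P. (\<Prod>k\<in>{1..4}. \<beta> k) * real (card {z. \<forall>k\<in>{1..4}. t (x k) z = \<beta> k}))" for x :: "nat \<Rightarrow> 'a"
  proof -
    define r where "r z = restrict (\<lambda>k. t (x k) z) {1..4}" for z
    have finP: "finite P" unfolding P_def by (intro finite_PiE) auto
    have "r z \<in> P" for z
      unfolding r_def P_def restrict_PiE_iff by (intro ballI t_values)
    then have rP: "r ` UNIV \<subseteq> P" by blast
    have eq: "{z. r z = \<beta>} = {z. \<forall>k\<in>{1..4}. t (x k) z = \<beta> k}" if "\<beta> \<in> P" for \<beta>
    proof -
      have "restrict \<beta> {1..4} = \<beta>" using that unfolding P_def by (rule PiE_restrict)
      moreover have "r z = restrict \<beta> {1..4}" if "\<forall>k\<in>{1..4}. t (x k) z = \<beta> k" for z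
        unfolding r_def by (rule restrict_ext) (use that in blast)
      moreover have "r z k = t (x k) z" if "k \<in> {1..4}" for z k using that by (simp add: r_def)
      ultimately show ?thesis by (metis (no_types, lifting) Collect_cong UNIV_I)
    qed
    have "(\<Sum>z\<in>UNIV. \<Prod>k\<in>{1..4}. t (x k) z) = (\<Sum>z\<in>UNIV. \<Prod>k\<in>{1..4}. r z k)"
      by (simp add: r_def)
    also have "\<dots> = (\<Sum>\<beta>\<in>P. \<Sum>z\<in>{z \<in> UNIV. r z = \<beta>}. \<Prod>k\<in>{1..4}. r z k)"
      by (rule sum.group[symmetric]) (use finP rP in auto)
    also have "\<dots> = (\<Sum>\<beta>\<in>P. \<Sum>z\<in>{z \<in> UNIV. r z = \<beta>}. \<Prod>k\<in>{1..4}. \<beta> k)"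
      by (intro sum.cong refl) auto
    also have "\<dots> = (\<Sum>\<beta>\<in>P. (\<Prod>k\<in>{1..4}. \<beta> k) * real (card {z. \<forall>k\<in>{1..4}. t (x k) z = \<beta> k}))"
      by (intro sum.cong refl) (simp add: eq mult.commute del: One_nat_def)
    finally show ?thesis .
  qed
  show ?thesis
    unfolding *[of x] *[of y] using assms by (intro sum.cong refl) (simp add: regular4_def)
qed

text \<open>The points \<open>a\<close> and \<open>b\<close> are the orthogonal pair for which the
  squared moments are summed. The bound \<open>2 < \<kappa>\<close> means that there is more than
  one class; it makes \<open>\<gamma>\<close> nonzero, so that it can be cancelled.\<close>

lemma excess_eq_1_if_regular:
  assumes reg: regular4 and "t a b = 0" and "2 < \<kappa>"
  shows "\<gamma> = 1"
proof -
  have ab: "b \<in> cls a" "t b a = 0" using assms(2) s_pos by (auto simp: cls_def t_sym)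
  txt \<open>Four mutually orthogonal points of a class stay in the same relations when one of them is
    replaced by its antipode, which changes the sign of the moment.\<close>
  have eq: "moment a b z w = \<gamma> * (t z a * t w b + t z b * t w a)"
    if zw: "z \<in> cls a" "w \<in> cls a" for z w
  proof -
    have orth: "t x y = 0" if "x \<in> cls a" "y \<in> cls a" "x \<noteq> y" "x \<noteq> antipode y" for x y
      using t_in_cls[of x y] that cls_eq t_sym by metis
    \<comment> \<open>A repeated argument brings the moment under \<open>moment_diag\<close>.
      Together with \<open>anti\<close> this settles the cases where \<open>z\<close> or
      \<open>w\<close> is \<open>a\<close> or \<open>b\<close> up to sign.\<close>
    have spec: "moment a b z a = \<gamma> * t z b" "moment a b z b = \<gamma> * t z a"
      "moment a b a z = \<gamma> * t z b" "moment a b b z = \<gamma> * t z a" for z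
      using moment_diag[of a b z] moment_diag[of b a z] ab assms(2)
      by (simp_all add: moment_def mult_ac t_sym)
    have anti: "moment a b (antipode z) w = - moment a b z w" "moment a b z (antipode w) = - moment a b z w" for z w
      by (simp_all add: moment_def t_antipode' sum_negf)
    consider "w \<in> {a, antipode a, b, antipode b}" | "z \<in> {a, antipode a, b, antipode b}" 
      | "w \<in> {z, antipode z}" "z \<notin> {a, antipode a, b, antipode b}"
      | "w \<notin> {a, antipode a, b, antipode b, z, antipode z}" "z \<notin> {a, antipode a, b, antipode b}" by blast
    then show ?thesis
    proof cases
      case 1
      then show ?thesis using ab assms(2) by (auto simp: spec anti t_refl t_antipode)
    next
      case 2
      then show ?thesis using ab assms(2) by (auto simp: spec anti t_refl t_antipode)
    next
      case 3
      then have z: "t z a = 0" "t z b = 0" using orth zw ab self_in_cls by auto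
      have "moment a b z z = 0"
        using moment_diag[of z a b] assms(2) z by (simp add: moment_def mult_ac)
      then show ?thesis using 3 z by (auto simp: anti)
    next
      case 4
      then have z: "t z a = 0" "t z b = 0" "t w a = 0" "t w b = 0" "t z w = 0"
        using orth zw ab self_in_cls antipode_antipode by (auto, metis)
      define x where "x k = (if k = 1 then a else if k = 2 then b else if k = 3 then z else w)" for k :: nat
      define y where "y = x(4 := antipode w)"
      have i: "{1..4::nat} = {1, 2, 3, 4}" by auto
      have "congruent4 x y"
        unfolding congruent4_def i using z ab assms(2)
        by (simp add: x_def y_def t_sym[of a z] t_sym[of a w] t_sym[of b z] t_sym[of b w] t_sym[of w z] t_antipode t_antipode' t_refl)
      from sum_prod_congruent[OF reg this]
      have "moment a b z w = moment a b z (antipode w)"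
        unfolding prod4 by (simp add: moment_def x_def y_def t_sym mult_ac)
      then show ?thesis using z by (simp add: anti)
    qed
  qed
  \<comment> \<open>The class is a frame with \<open>r = 2\<close>. In the square of
    \<open>eq\<close> the mixed product sums to zero, as \<open>t a b = 0\<close>, and the other two
    give 4 each, whence \<open>8 * \<gamma>\<^sup>2\<close>.\<close>
  have fr: "(\<Sum>z\<in>cls a. t z x * t z y) = 2 * t x y" for x y by (rule sum_cls)
  have "(\<Sum>z\<in>cls a. \<Sum>w\<in>cls a. (moment a b z w)\<^sup>2)
      = (\<Sum>z\<in>cls a. \<Sum>w\<in>cls a. \<gamma>\<^sup>2 * ((t z a * t w b) * (t z a * t w b) + 2 * ((t z a * t w b) * (t z b * t w a))
          + (t z b * t w a) * (t z b * t w a)))"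
    by (intro sum.cong refl) (simp add: eq power2_eq_square algebra_simps)
  also have "\<dots> = \<gamma>\<^sup>2 * 8"
    using ab assms(2)
    by (simp add: sum.distrib frame_pairings[OF fr] t_refl flip: sum_distrib_left)
  finally have "8 * \<gamma> = 8 * \<gamma>\<^sup>2"
    using double_sum_moment(2)[OF fr, of a b] assms(2) by simp
  moreover have "\<gamma> \<noteq> 0" using assms(3) s_pos by (simp add: excess_def)
  ultimately show ?thesis by (simp add: power2_eq_square)
qed

section \<open>Evaluation of all quadruple counts when \<open>\<gamma> = 1\<close>\<close>

lemma sum_antipode: "(\<Sum>z\<in>UNIV. g (antipode z)) = (\<Sum>z\<in>UNIV. g z)"
  by (rule sum.reindex_bij_witness[of _ antipode antipode]) (auto simp: antipode_antipode)

lemma sum_cls_antipode: "(\<Sum>z\<in>cls w. g (antipode z)) = (\<Sum>z\<in>cls w. g z)"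
  by (rule sum.reindex_bij_witness[of _ antipode antipode])
    (auto simp: antipode_antipode antipode_in_cls)

text \<open>Passing to antipodes preserves sums over \<open>A\<close> but changes the sign of an odd
  number of factors.\<close>

lemma sum_prod_odd:
  assumes "\<And>g :: 'a \<Rightarrow> real. (\<Sum>z\<in>A. g (antipode z)) = (\<Sum>z\<in>A. g z)" and "odd (card S)"
  shows "(\<Sum>z\<in>A. \<Prod>k\<in>S. t (x k) z) = 0"
proof -
  have "(\<Sum>z\<in>A. \<Prod>k\<in>S. t (x k) z) = (\<Sum>z\<in>A. \<Prod>k\<in>S. t (x k) (antipode z))"
    by (rule assms(1)[symmetric])
  also have "\<dots> = (\<Sum>z\<in>A. - (\<Prod>k\<in>S. t (x k) z))"
  proof (intro sum.cong refl)
    fix z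
    have "(\<Prod>k\<in>S. t (x k) (antipode z)) = (\<Prod>k\<in>S. (-1) * t (x k) z)"
      by (simp add: t_antipode')
    then show "(\<Prod>k\<in>S. t (x k) (antipode z)) = - (\<Prod>k\<in>S. t (x k) z)"
      using assms(2) by (simp only: prod.distrib prod_constant) simp
  qed
  finally show ?thesis by (simp add: sum_negf)
qed

text \<open>At most three factors occur: odd numbers of them sum to zero, the empty product counts
  the set, and two factors fall under the frame identity. Separate sets \<open>A\<close> and
  \<open>B\<close> allow the class of \<open>x k\<close> to be compared with that of
  \<open>y k\<close>.\<close>

lemma sum_prod_frame_congruent:
  assumes xy: "congruent4 x y" and S: "S \<subseteq> {1..4}" "S \<noteq> {1..4}"
    and anti: "\<And>g :: 'a \<Rightarrow> real. (\<Sum>z\<in>A. g (antipode z)) = (\<Sum>z\<in>A. g z)"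
      "\<And>g :: 'a \<Rightarrow> real. (\<Sum>z\<in>B. g (antipode z)) = (\<Sum>z\<in>B. g z)"
    and frame: "\<And>x y. (\<Sum>z\<in>A. t z x * t z y) = r * t x y" "\<And>x y. (\<Sum>z\<in>B. t z x * t z y) = r * t x y"
    and "card A = card B"
  shows "(\<Sum>z\<in>A. \<Prod>k\<in>S. t (x k) z) = (\<Sum>z\<in>B. \<Prod>k\<in>S. t (y k) z)"
proof -
  have "card S < card {1..4::nat}" using S by (intro psubset_card_mono) auto
  then consider "odd (card S)" | "card S = 0" | "card S = 2" by fastforce
  then show ?thesis
  proof cases
    case 1
    then show ?thesis using anti by (simp add: sum_prod_odd)
  next
    case 2
    then have "S = {}" using S(1) finite_subset by fastforce
    then show ?thesis using assms(8) by simp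
  next
    case 3
    then obtain k l where kl: "S = {k, l}" "k \<noteq> l" by (auto simp: card_2_iff)
    have "t (x k) (x l) = t (y k) (y l)" using xy S(1) kl unfolding congruent4_def by blast
    moreover have "(\<Sum>z\<in>A. t p z * t q z) = r * t p q" "(\<Sum>z\<in>B. t p z * t q z) = r * t p q" for p q
      using frame[of p q] by (simp_all add: t_sym)
    ultimately show ?thesis using kl by simp
  qed
qed

lemma card_cls_eq: "card (cls x) = card (cls y)"
proof -
  have "real (card (cls x)) * s\<^sup>2 = real (card (cls y)) * s\<^sup>2" by (simp only: card_cls)
  then show ?thesis using s_pos by simp
qed

text \<open>A basis of the functions of the relation between two points. It replaces the indicators of the
  relations: all sums of products of four of these functions can be evaluated.\<close>

definition rel_basis :: "nat \<Rightarrow> real \<Rightarrow> real" where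
  "rel_basis g \<tau> = (if g = 0 then 1 else if g = 1 then of_bool (\<bar>\<tau>\<bar> \<noteq> s)
     else if g = 2 then of_bool (\<tau> = 1) else if g = 3 then of_bool (\<tau> = -1) else \<tau>)"

lemma rel_basis_spans:
  "\<exists>c. \<forall>\<tau>\<in>{1, s, 0, -s, -1}. of_bool (\<tau> = \<beta>) = (\<Sum>g<5. c g * rel_basis g \<tau>)"
proof -
  have sum5: "(\<Sum>g<5. h g) = h 0 + h 1 + h 2 + h 3 + h 4" for h :: "nat \<Rightarrow> real"
    by (simp add: eval_nat_numeral)
  have sn: "s \<noteq> 0" "s \<noteq> 1" "s \<noteq> -1" "\<bar>s\<bar> = s" using s_pos s_less_1 by auto
  \<comment> \<open>For \<open>\<beta> = s\<close> and \<open>\<beta> = -s\<close>: 1 minus the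
    class indicator is the sum of the indicators of \<open>s\<close> and \<open>-s\<close>, and
    \<open>\<tau>\<close> minus the indicator of 1 plus that of -1 is \<open>s\<close> times their
    difference. For \<open>\<beta>\<close> outside the five values, zero coefficients are
    right.\<close>
  define c :: "nat \<Rightarrow> real" where "c = (if \<beta> = 1 then (\<lambda>g. of_bool (g = 2)) else if \<beta> = -1 then (\<lambda>g. of_bool (g = 3))
    else if \<beta> = 0 then (\<lambda>g. if g = 1 then 1 else if g = 2 \<or> g = 3 then -1 else 0)
    else if \<beta> = s then (\<lambda>g. if g = 0 then 1/2 else if g = 1 then -1/2 else if g = 2 then -1/(2 * s)
       else if g = 3 then 1/(2 * s) else 1/(2 * s))
    else if \<beta> = -s then (\<lambda>g. if g = 0 then 1/2 else if g = 1 then -1/2 else if g = 2 then 1/(2 * s)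
       else if g = 3 then -1/(2 * s) else -1/(2 * s))
    else (\<lambda>g. 0))"
  have "\<forall>\<tau>\<in>{1, s, 0, -s, -1}. of_bool (\<tau> = \<beta>) = (\<Sum>g<5. c g * rel_basis g \<tau>)"
    unfolding sum5 using sn by (auto simp: c_def rel_basis_def)
  then show ?thesis by blast
qed

text \<open>Classes partition the points, so they meet only if they coincide.\<close>

lemma Inter_cls:
  assumes "k \<in> U"
  shows "{z. \<forall>l\<in>U. z \<in> cls (x l)} = (if \<forall>l\<in>U. x l \<in> cls (x k) then cls (x k) else {})"
proof -
  have 1: "x l \<in> cls (x k)" if "z \<in> cls (x k)" "z \<in> cls (x l)" for z l
  proof -
    have "cls z = cls (x k)" using that(1) by (rule cls_eq)
    moreover have "x l \<in> cls z" using that(2) cls_sym by blast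
    ultimately show ?thesis by (rule subst)
  qed
  have 2: "z \<in> cls (x l)" if "z \<in> cls (x k)" "x l \<in> cls (x k)" for z l
    unfolding cls_eq[OF that(2)] by (rule that(1))
  show ?thesis
  proof (cases "\<forall>l\<in>U. x l \<in> cls (x k)")
    case True
    then have "z \<in> cls (x l)" if "z \<in> cls (x k)" "l \<in> U" for z l using 2 that by blast
    then have "{z. \<forall>l\<in>U. z \<in> cls (x l)} = cls (x k)" using assms by blast
    then show ?thesis using True by simp
  next
    case False
    then obtain l where "l \<in> U" "x l \<notin> cls (x k)" by blast
    then have "\<not> (\<forall>l\<in>U. z \<in> cls (x l))" for z using 1 assms by blast
    then have "{z. \<forall>l\<in>U. z \<in> cls (x l)} = {}" by blast
    then show ?thesis unfolding if_not_P[OF False] .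
  qed
qed

text \<open>An indicator of a point or antipode collapses the sum to one term. A class indicator
  restricts it to one class and leaves at most three linear factors. Otherwise only linear factors
  remain, and four of them form a moment.\<close>

lemma sum_prod_rel_basis_congruent:
  assumes "\<gamma> = 1" and xy: "congruent4 x y"
  shows "(\<Sum>z\<in>UNIV. \<Prod>k\<in>{1..4}. rel_basis (p k) (t (x k) z))
       = (\<Sum>z\<in>UNIV. \<Prod>k\<in>{1..4}. rel_basis (p k) (t (y k) z))"
proof -
  have eqt: "t (x k) (x l) = t (y k) (y l)" if "k \<in> {1..4}" "l \<in> {1..4}" for k l
    using xy that unfolding congruent4_def by blast
  consider (eq) k where "k \<in> {1..4}" "p k = 2" | (anti) k where "k \<in> {1..4}" "p k = 3"
    | (cls) k where "k \<in> {1..4}" "p k = 1" "\<forall>k\<in>{1..4}. p k \<noteq> 2 \<and> p k \<noteq> 3"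
    | (full) "\<forall>k\<in>{1..4}. p k \<noteq> 1 \<and> p k \<noteq> 2 \<and> p k \<noteq> 3" by blast
  then show ?thesis
  proof cases
    case eq
    have "(\<Sum>z\<in>UNIV. \<Prod>l\<in>{1..4}. rel_basis (p l) (t (x l) z))
        = (\<Sum>z\<in>{x k}. \<Prod>l\<in>{1..4}. rel_basis (p l) (t (x l) z))" for x
      using eq by (intro sum.mono_neutral_right ballI prod_zero)
        (auto intro!: bexI[of _ k] simp: rel_basis_def t_eq_1_iff)
    then show ?thesis using eq eqt by simp
  next
    case anti
    have "(\<Sum>z\<in>UNIV. \<Prod>l\<in>{1..4}. rel_basis (p l) (t (x l) z))
        = (\<Sum>z\<in>{antipode (x k)}. \<Prod>l\<in>{1..4}. rel_basis (p l) (t (x l) z))" for x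
      using anti by (intro sum.mono_neutral_right ballI prod_zero)
        (auto intro!: bexI[of _ k] simp: rel_basis_def t_eq_minus_1)
    then show ?thesis using anti eqt by (simp add: t_antipode')
  next
    case cls
    \<comment> \<open>\<open>U\<close> holds the positions of class indicators, which cut the sum
      down to one class or to nothing. \<open>S\<close> holds the linear factors, at most three
      because \<open>k\<close> lies in \<open>U\<close>.\<close>
    define U where "U = {l \<in> {1..4}. p l = 1}"
    define S where "S = {l \<in> {1..4}. p l \<noteq> 0 \<and> p l \<noteq> 1}"
    have *: "(\<Sum>z\<in>UNIV. \<Prod>l\<in>{1..4}. rel_basis (p l) (t (x l) z))
        = (if \<forall>l\<in>U. \<bar>t (x k) (x l)\<bar> \<noteq> s then \<Sum>z\<in>cls (x k). \<Prod>l\<in>S. t (x l) z else 0)" for x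
    proof -
      have "(\<Prod>l\<in>{1..4}. rel_basis (p l) (t (x l) z))
          = (if \<forall>l\<in>U. z \<in> cls (x l) then \<Prod>l\<in>S. t (x l) z else 0)" for z
      proof (cases "\<forall>l\<in>U. z \<in> cls (x l)")
        case True
        have "(\<Prod>l\<in>{1..4}. rel_basis (p l) (t (x l) z)) = (\<Prod>l\<in>S. rel_basis (p l) (t (x l) z))"
          using True by (intro prod.mono_neutral_right) (auto simp: S_def U_def rel_basis_def cls_def)
        also have "\<dots> = (\<Prod>l\<in>S. t (x l) z)"
          using cls by (intro prod.cong) (auto simp: S_def rel_basis_def)
        finally show ?thesis using True by simp
      next
        case False
        then obtain l where "l \<in> U" "z \<notin> cls (x l)" by blast
        then have 0: "(\<Prod>l\<in>{1..4}. rel_basis (p l) (t (x l) z)) = 0"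
          by (intro prod_zero) (auto intro!: bexI[of _ l] simp: U_def rel_basis_def cls_def)
        show ?thesis unfolding 0 using False by auto
      qed
      then have "(\<Sum>z\<in>UNIV. \<Prod>l\<in>{1..4}. rel_basis (p l) (t (x l) z))
          = (\<Sum>z\<in>{z. \<forall>l\<in>U. z \<in> cls (x l)}. \<Prod>l\<in>S. t (x l) z)"
        by (simp add: sum.If_cases)
      moreover have "{z. \<forall>l\<in>U. z \<in> cls (x l)} = (if \<forall>l\<in>U. \<bar>t (x k) (x l)\<bar> \<noteq> s then cls (x k) else {})"
      proof -
        have "k \<in> U" using cls by (simp add: U_def)
        then show ?thesis using Inter_cls[of k U x] by (simp add: cls_def)
      qed
      ultimately show ?thesis by simp
    qed
    have "(\<forall>l\<in>U. \<bar>t (x k) (x l)\<bar> \<noteq> s) \<longleftrightarrow> (\<forall>l\<in>U. \<bar>t (y k) (y l)\<bar> \<noteq> s)"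
      using eqt cls(1) by (simp add: U_def)
    moreover have "(\<Sum>z\<in>cls (x k). \<Prod>l\<in>S. t (x l) z) = (\<Sum>z\<in>cls (y k). \<Prod>l\<in>S. t (y l) z)"
      by (rule sum_prod_frame_congruent[OF xy])
        (use cls in \<open>auto simp: S_def sum_cls_antipode intro!: sum_cls card_cls_eq\<close>)
    ultimately show ?thesis by (simp only: *)
  next
    case full
    define S where "S = {l \<in> {1..4}. p l \<noteq> 0}"
    have *: "(\<Prod>l\<in>{1..4}. rel_basis (p l) (t (x l) z)) = (\<Prod>l\<in>S. t (x l) z)" for x z
    proof -
      have "(\<Prod>l\<in>{1..4}. rel_basis (p l) (t (x l) z)) = (\<Prod>l\<in>S. rel_basis (p l) (t (x l) z))"
        by (intro prod.mono_neutral_right) (auto simp: S_def rel_basis_def)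
      also have "\<dots> = (\<Prod>l\<in>S. t (x l) z)"
        using full by (intro prod.cong) (auto simp: S_def rel_basis_def)
      finally show ?thesis .
    qed
    show ?thesis
    proof (cases "S = {1..4}")
      case True
      \<comment> \<open>With four linear factors the sum is a genuine fourth moment, and
        \<open>\<gamma> = 1\<close> enters through \<open>moment_eq\<close>.\<close>
      have m: "(\<Sum>z\<in>UNIV. \<Prod>l\<in>{1..4}. t (x l) z) = moment (x 1) (x 2) (x 3) (x 4)" for x :: "nat \<Rightarrow> 'a"
        unfolding prod4 moment_def by (simp add: t_sym)
      show ?thesis unfolding * True m moment_eq[OF assms(1)] by (simp add: eqt)
    next
      case False
      show ?thesis unfolding *
        by (rule sum_prod_frame_congruent[OF xy])
          (use False in \<open>auto simp: S_def sum_antipode intro!: t_conv'\<close>)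
    qed
  qed
qed

text \<open>Expanding each indicator in \<open>rel_basis\<close> and multiplying out makes every
  count a combination of the sums in \<open>sum_prod_rel_basis_congruent\<close>, with coefficients
  independent of the quadruple.\<close>

lemma regular_if_excess_eq_1:
  assumes "\<gamma> = 1"
  shows regular4
  unfolding regular4_def
proof (intro allI impI)
  fix x y :: "nat \<Rightarrow> 'a" and \<beta> :: "nat \<Rightarrow> real"
  assume xy: "congruent4 x y"
  have "\<forall>k. \<exists>c. \<forall>\<tau>\<in>{1, s, 0, -s, -1}. of_bool (\<tau> = \<beta> k) = (\<Sum>g<5. c g * rel_basis g \<tau>)"
    using rel_basis_spans by blast
  then obtain c where c: "\<And>k \<tau>. \<tau> \<in> {1, s, 0, -s, -1} \<Longrightarrow> of_bool (\<tau> = \<beta> k) = (\<Sum>g<5. c k g * rel_basis g \<tau>)"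
    by metis
  have *: "real (card {z. \<forall>k\<in>{1..4}. t (x k) z = \<beta> k})
      = (\<Sum>p\<in>{1..4} \<rightarrow>\<^sub>E {..<5}. (\<Prod>k\<in>{1..4}. c k (p k)) * (\<Sum>z\<in>UNIV. \<Prod>k\<in>{1..4}. rel_basis (p k) (t (x k) z)))"
    for x :: "nat \<Rightarrow> 'a"
  proof -
    have "real (card {z. \<forall>k\<in>{1..4}. t (x k) z = \<beta> k}) = (\<Sum>z\<in>UNIV. of_bool (\<forall>k\<in>{1..4}. t (x k) z = \<beta> k))"
      by simp
    also have "\<dots> = (\<Sum>z\<in>UNIV. \<Prod>k\<in>{1..4}. of_bool (t (x k) z = \<beta> k))"
      by (intro sum.cong refl) (auto simp: prod_zero_iff)
    also have "\<dots> = (\<Sum>z\<in>UNIV. \<Prod>k\<in>{1..4}. \<Sum>g<5. c k g * rel_basis g (t (x k) z))"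
      by (simp only: c[OF t_values])
    also have "\<dots> = (\<Sum>z\<in>UNIV. \<Sum>p\<in>{1..4} \<rightarrow>\<^sub>E {..<5}. \<Prod>k\<in>{1..4}. c k (p k) * rel_basis (p k) (t (x k) z))"
      by (subst prod_sum_PiE) auto
    also have "\<dots> = (\<Sum>p\<in>{1..4} \<rightarrow>\<^sub>E {..<5}. \<Sum>z\<in>UNIV. \<Prod>k\<in>{1..4}. c k (p k) * rel_basis (p k) (t (x k) z))"
      by (rule sum.swap)
    finally show ?thesis by (simp only: prod.distrib sum_distrib_left)
  qed
  have "real (card {z. \<forall>k\<in>{1..4}. t (x k) z = \<beta> k}) = real (card {z. \<forall>k\<in>{1..4}. t (y k) z = \<beta> k})"
    unfolding *[of x] *[of y] using sum_prod_rel_basis_congruent[OF assms xy] by simp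
  then show "card {z. \<forall>k\<in>{1..4}. t (x k) z = \<beta> k} = card {z. \<forall>k\<in>{1..4}. t (y k) z = \<beta> k}"
    by simp
qed

end

section \<open>Four-class Q-antipodal Q-bipartite schemes\<close>

text \<open>The intersection numbers at \<open>R 0\<close> say that all points have equally many
  neighbours in \<open>R i\<close>, and \<open>nonempty\<close> makes this number positive.\<close>

lemma (in symmetric_association_scheme) valency:
  assumes "i \<le> D"
  shows "\<exists>y. (x, y) \<in> R i"
proof -
  obtain p where p: "\<forall>x y. (x, y) \<in> R 0 \<longrightarrow> card {z. (x, z) \<in> R i \<and> (z, y) \<in> R i} = p"
    using intersection_numbers[of i i 0] assms by auto
  then have card: "card {z. (x, z) \<in> R i \<and> (z, x) \<in> R i} = p" for x by (simp add: diagonal)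
  obtain a b where "(a, b) \<in> R i" using nonempty[OF assms] by auto
  then have "b \<in> {z. (a, z) \<in> R i \<and> (z, a) \<in> R i}" using rel_sym assms by blast
  then have "p \<noteq> 0" using card[of a] by (metis card_0_eq finite empty_iff)
  then have "{z. (x, z) \<in> R i \<and> (z, x) \<in> R i} \<noteq> {}" using card[of x] by (metis card.empty)
  then show ?thesis by blast
qed

lemma sum_to_4: "(\<Sum>k\<le>4. h k) = h 0 + h 1 + h 2 + h 3 + (h (4 :: nat) :: real)"
  by (simp add: eval_nat_numeral)

locale bipartite_antipodal_scheme = Q_polynomial_scheme 4 R E
  for R :: "nat \<Rightarrow> 'a::finite rel" and E +
  assumes bipartite: "Q_bipartite 4 E" and antipodal: "Q_antipodal 4 E"
begin

declare One_nat_def [simp del]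

definition V :: "nat \<Rightarrow> 'a \<Rightarrow> 'a \<Rightarrow> real" where "V k x y = real CARD('a) * E k $ x $ y"

definition m :: real where "m = V 1 undefined undefined"

text \<open>This is \<open>c_star 4 E 2\<close>, the only parameter besides \<open>m\<close> in
  \<open>krein_values\<close>.\<close>

definition \<mu> :: real where "\<mu> = krein 4 E 1 1 2"

lemma V_diag: "V 1 x x = m"
  unfolding m_def V_def using BM_diag[OF E_BM[of 1]] by simp

lemma m_pos: "0 < m"
  unfolding m_def V_def using E_diag_pos[of 1] by simp

lemma V_0: "V 0 x y = 1"
  by (simp add: V_def E_0)

text \<open>For each upper index, \<open>krein_eq_0\<close> and bipartiteness leave at most two
  nonzero numbers, which add up to \<open>m\<close> by \<open>sum_krein\<close>. Antipodality at
  \<open>j = 1\<close> carries a value from upper index 1 to upper index 3.\<close>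

lemma krein_values:
  "krein 4 E 1 1 0 = m" "krein 4 E 1 2 1 = m - 1" "krein 4 E 1 2 3 = m - 1"
  "krein 4 E 1 3 2 = m - \<mu>" "krein 4 E 1 3 4 = m" "krein 4 E 1 4 3 = 1"
proof -
  have row: "krein 4 E 1 0 k + krein 4 E 1 1 k + krein 4 E 1 2 k + krein 4 E 1 3 k + krein 4 E 1 4 k = m"
    if "k \<le> 4" for k
    using sum_krein[of 1 k undefined] that by (simp add: sum_to_4 m_def V_def)
  have a: "krein 4 E 1 k k = 0" if "k \<le> 4" for k
    using bipartite that unfolding Q_bipartite_def a_star_def by blast
  have z: "krein 4 E 1 j k = 0" if "j + 2 \<le> k \<or> k + 2 \<le> j" "j \<le> 4" "k \<le> 4" for j k
    using that by (intro krein_eq_0) auto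
  show 10: "krein 4 E 1 1 0 = m" using row[of 0] a[of 0] by (simp add: z)
  have "krein 4 E 1 0 1 = 1" using krein_0[of 1 1] by simp
  then show 21: "krein 4 E 1 2 1 = m - 1" using row[of 1] a[of 1] by (simp add: z)
  have "b_star 4 E 1 = c_star 4 E (4 - 1)"
    using antipodal unfolding Q_antipodal_def by (elim allE[of _ 1]) simp
  then show 23: "krein 4 E 1 2 3 = m - 1"
    using 21 by (simp add: b_star_def c_star_def)
  show "krein 4 E 1 3 2 = m - \<mu>" using row[of 2] a[of 2] by (simp add: z \<mu>_def)
  show "krein 4 E 1 4 3 = 1" using row[of 3] a[of 3] 23 by (simp add: z)
  show "krein 4 E 1 3 4 = m" using row[of 4] a[of 4] by (simp add: z)
qed

lemma V_equations:
  "(V 1 x y)\<^sup>2 = m + \<mu> * V 2 x y" "V 1 x y * V 2 x y = (m - 1) * (V 1 x y + V 3 x y)"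
  "V 1 x y * V 3 x y = (m - \<mu>) * V 2 x y + m * V 4 x y" "V 1 x y * V 4 x y = V 3 x y"
proof -
  have a: "krein 4 E 1 k k = 0" if "k \<le> 4" for k
    using bipartite that unfolding Q_bipartite_def a_star_def by blast
  have z: "krein 4 E 1 j k = 0" if "j + 2 \<le> k \<or> k + 2 \<le> j" "j \<le> 4" "k \<le> 4" for j k
    using that by (intro krein_eq_0) auto
  have V: "V 1 x y * V j x y = krein 4 E 1 j 0 * V 0 x y + krein 4 E 1 j 1 * V 1 x y
      + krein 4 E 1 j 2 * V 2 x y + krein 4 E 1 j 3 * V 3 x y + krein 4 E 1 j 4 * V 4 x y" if "j \<le> 4" for j
    using krein_entry[of 1 j x y] that by (simp add: V_def sum_to_4 mult_ac)
  show "(V 1 x y)\<^sup>2 = m + \<mu> * V 2 x y"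
    using V[of 1] krein_values a[of 1] by (simp add: z V_0 power2_eq_square flip: \<mu>_def)
  show "V 1 x y * V 2 x y = (m - 1) * (V 1 x y + V 3 x y)"
    using V[of 2] krein_values a[of 2] by (simp add: z algebra_simps)
  show "V 1 x y * V 3 x y = (m - \<mu>) * V 2 x y + m * V 4 x y"
    using V[of 3] krein_values a[of 3] by (simp add: z)
  show "V 1 x y * V 4 x y = V 3 x y"
    using V[of 4] krein_values a[of 4] by (simp add: z)
qed

section \<open>The five entries of \<open>|X| E 1\<close>, that is, the dual eigenvalues\<close>

definition rep :: "nat \<Rightarrow> real" where "rep i = (SOME \<tau>. \<exists>x y. (x, y) \<in> R i \<and> V 1 x y = \<tau>)"

lemma rel_iff:
  assumes "i \<le> 4"
  shows "(x, y) \<in> R i \<longleftrightarrow> V 1 x y = rep i"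
proof -
  have "\<exists>\<tau>. \<exists>x y. (x, y) \<in> R i \<and> V 1 x y = \<tau>" using nonempty[OF assms] by auto
  from someI_ex[OF this] obtain a b where ab: "(a, b) \<in> R i" "V 1 a b = rep i"
    unfolding rep_def by blast
  obtain j where j: "j \<le> 4" "(x, y) \<in> R j" using ex_rel by blast
  have "V 1 x y = V 1 a b" if "(x, y) \<in> R i"
    using E_BM[of 1] assms that ab(1) unfolding BM_iff V_def by fastforce
  moreover have "j = i" if "V 1 x y = V 1 a b"
    using E_1_distinct[OF j(1) assms j(2) ab(1)] that by (simp add: V_def)
  ultimately show ?thesis using ab j by auto
qed

lemma card_rep: "card (rep ` {..4}) = 5"
proof -
  have "inj_on rep {..4}"
  proof (rule inj_onI)
    fix i j assume ij: "i \<in> {..4}" "j \<in> {..4}" "rep i = rep j"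
    obtain x y where "(x, y) \<in> R i" using nonempty[of i] ij by auto
    moreover from this have "(x, y) \<in> R j" using rel_iff ij by simp
    ultimately show "i = j" using rel_unique ij by auto
  qed
  then show ?thesis by (simp add: card_image)
qed

lemma rep_in: 
  assumes "\<And>x y. V 1 x y \<in> S" "i \<le> 4"
  shows "rep i \<in> S"
proof -
  obtain x y where "(x, y) \<in> R i" using nonempty[OF assms(2)] by auto
  then show ?thesis using assms rel_iff by metis
qed

text \<open>Otherwise \<open>V 1\<close> squares to \<open>m\<close> everywhere and takes at most
  two values, while the relations require five.\<close>

lemma \<mu>_nonzero: "\<mu> \<noteq> 0"
proof
  assume "\<mu> = 0"
  have "V 1 x y \<in> {sqrt m, - sqrt m}" for x y
  proof -
    have "(V 1 x y)\<^sup>2 = (sqrt m)\<^sup>2" using V_equations(1)[of x y] \<open>\<mu> = 0\<close> m_pos by simp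
    then show ?thesis by (simp only: power2_eq_iff) auto
  qed
  then have "rep ` {..4} \<subseteq> {sqrt m, - sqrt m}" using rep_in by blast
  then have "card (rep ` {..4}) \<le> card {sqrt m, - sqrt m}" by (intro card_mono) auto
  also have "\<dots> \<le> 2" by (simp add: card_insert_if)
  finally show False using card_rep by simp
qed

text \<open>Replacing \<open>V 3\<close> by \<open>V 1 * V 4\<close> and cancelling
  \<open>V 1\<close> in the second of \<open>V_equations\<close> gives the first claim. Substituting
  for \<open>(V 1 x y)\<^sup>2\<close> in the third makes \<open>V 2 x y\<close> split off as a
  factor.\<close>

lemma V_2_V_4:
  assumes "V 1 x y \<noteq> 0"
  shows "V 2 x y = (m - 1) * (1 + V 4 x y)" "V 2 x y = 0 \<or> \<mu> * V 4 x y = m - \<mu>"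
proof -
  have "V 1 x y * V 2 x y = V 1 x y * ((m - 1) * (1 + V 4 x y))"
    using V_equations(2,4)[of x y] by (simp add: algebra_simps)
  then show "V 2 x y = (m - 1) * (1 + V 4 x y)" using assms by simp
  have "V 1 x y * (V 1 x y * V 4 x y) = (m - \<mu>) * V 2 x y + m * V 4 x y"
    using V_equations(3,4)[of x y] by simp
  then have "(V 1 x y)\<^sup>2 * V 4 x y = (m - \<mu>) * V 2 x y + m * V 4 x y"
    by (simp add: power2_eq_square mult.assoc)
  then have "(m + \<mu> * V 2 x y) * V 4 x y = (m - \<mu>) * V 2 x y + m * V 4 x y"
    unfolding V_equations(1) .
  then have "V 2 x y * (\<mu> * V 4 x y - (m - \<mu>)) = 0" by (simp add: algebra_simps)
  then show "V 2 x y = 0 \<or> \<mu> * V 4 x y = m - \<mu>" by simp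
qed

text \<open>Where \<open>V 1\<close> vanishes the equations fix \<open>V 4\<close>; elsewhere the
  alternatives of \<open>V_2_V_4\<close> give \<open>m\<close> or \<open>m\<^sup>2\<close> as its
  square. The first disjunct will describe pairs within a class, the second pairs from different
  classes.\<close>

lemma V_1_values: "V 1 x y \<in> {0, m, - m} \<and> \<mu> * V 4 x y = m - \<mu> \<or> V 1 x y \<in> {sqrt m, - sqrt m} \<and> V 2 x y = 0"
proof (cases "V 1 x y = 0")
  case True
  then have 2: "\<mu> * V 2 x y = - m" "(m - \<mu>) * V 2 x y + m * V 4 x y = 0"
    using V_equations(1,3)[of x y] by simp_all
  then have "\<mu> * ((m - \<mu>) * V 2 x y + m * V 4 x y) = 0" by simp
  then have "(m - \<mu>) * (\<mu> * V 2 x y) + m * (\<mu> * V 4 x y) = 0" by (simp add: algebra_simps)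
  then have "m * (\<mu> * V 4 x y) = m * (m - \<mu>)" unfolding 2 by (simp add: algebra_simps)
  then show ?thesis using True m_pos by simp
next
  case False
  from V_2_V_4(2)[OF False] show ?thesis
  proof
    assume "V 2 x y = 0"
    moreover from this have "(V 1 x y)\<^sup>2 = (sqrt m)\<^sup>2" using V_equations(1)[of x y] m_pos by simp
    ultimately show ?thesis by (simp only: power2_eq_iff) auto
  next
    assume 4: "\<mu> * V 4 x y = m - \<mu>"
    have "\<mu> * V 2 x y = (m - 1) * (\<mu> + \<mu> * V 4 x y)"
      unfolding V_2_V_4(1)[OF False] by (simp add: algebra_simps)
    then have "(V 1 x y)\<^sup>2 = m\<^sup>2"
      using V_equations(1)[of x y] 4 by (simp add: algebra_simps power2_eq_square)
    then show ?thesis using 4 by (simp only: power2_eq_iff) auto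
  qed
qed

text \<open>Five distinct values lie in a list of at most five numbers, so all of these occur and no
  two coincide.\<close>

lemma rep_image: "rep ` {..4} = {0, m, - m, sqrt m, - sqrt m}"
proof (rule card_subset_eq)
  show "rep ` {..4} \<subseteq> {0, m, - m, sqrt m, - sqrt m}"
    using V_1_values by (intro image_subsetI rep_in) auto
  then have "5 \<le> card {0, m, - m, sqrt m, - sqrt m}"
    using card_mono[of "{0, m, - m, sqrt m, - sqrt m}" "rep ` {..4}"] card_rep by simp
  moreover have "card {0, m, - m, sqrt m, - sqrt m} \<le> 5"
    by (simp add: card_insert_if)
  ultimately show "card (rep ` {..4}) = card {0, m, - m, sqrt m, - sqrt m}" using card_rep by simp
qed simp

lemma E_inner: "E 1 $ x \<bullet> E 1 $ y = E 1 $ x $ y"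
proof -
  have "(E 1 ** E 1) $ x $ y = E 1 $ x \<bullet> E 1 $ y"
    using E_sym[of 1 _ y] by (simp add: matrix_matrix_mult_def inner_vec_def)
  then show ?thesis using E_mult[of 1 1] by simp
qed

text \<open>The entry \<open>sqrt m\<close> occurs, so Cauchy-Schwarz for rows of \<open>E 1\<close>
  gives \<open>m \<le> m\<^sup>2\<close>; and \<open>m = 1\<close> would merge values in
  \<open>rep_image\<close>.\<close>

lemma m_greater_1: "1 < m"
proof -
  have "sqrt m \<in> rep ` {..4}" unfolding rep_image by simp
  then obtain i where i: "i \<le> 4" "rep i = sqrt m" by auto
  obtain x y where "(x, y) \<in> R i" using nonempty[OF i(1)] by auto
  then have xy: "V 1 x y = sqrt m" using rel_iff i by simp
  have "(E 1 $ x $ y)\<^sup>2 \<le> E 1 $ x $ x * E 1 $ y $ y"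
    using Cauchy_Schwarz_ineq[of "E 1 $ x" "E 1 $ y"] by (simp add: E_inner)
  then have "(real CARD('a))\<^sup>2 * (E 1 $ x $ y)\<^sup>2 \<le> (real CARD('a))\<^sup>2 * (E 1 $ x $ x * E 1 $ y $ y)"
    by (intro mult_left_mono) auto
  then have "(V 1 x y)\<^sup>2 \<le> V 1 x x * V 1 y y"
    by (simp add: V_def power2_eq_square mult_ac)
  then have "m \<le> m * m" using m_pos by (simp add: xy V_diag)
  then have "1 \<le> m" using m_pos by simp
  moreover have "m \<noteq> 1"
  proof
    assume "m = 1"
    then have "card (rep ` {..4}) \<le> 3" unfolding rep_image by (simp add: card_insert_if)
    then show False using card_rep by simp
  qed
  ultimately show ?thesis by simp
qed

section \<open>The unbiased bases attached to the scheme\<close>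

definition gram :: "'a \<Rightarrow> 'a \<Rightarrow> real" where "gram x y = V 1 x y / m"

text \<open>The entries of \<open>E 0 + E 4\<close> are \<open>(1 + V 4 x y) / |X|\<close>, and the
  alternatives of \<open>V_1_values\<close> make the numerator \<open>m / \<mu>\<close> or 0.
  Classes defined by inner products thus agree with the Q-antipodal relation.\<close>

lemma gram_abs_iff: "\<bar>gram x y\<bar> \<noteq> 1 / sqrt m \<longleftrightarrow> (E 0 + E 4) $ x $ y \<noteq> 0"
  and E_0_4_values: "(E 0 + E 4) $ x $ y \<in> {0, m / (\<mu> * real CARD('a))}"
proof -
  have K: "(E 0 + E 4) $ x $ y = (1 + V 4 x y) / real CARD('a)"
    by (simp add: E_0 V_def field_simps)
  have s: "sqrt m / m = 1 / sqrt m"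
    using sqrt_divide_self_eq[of m] m_pos by (simp add: inverse_eq_divide)
  from V_1_values[of x y] consider
    (same) "V 1 x y \<in> {0, m, - m}" "\<mu> * V 4 x y = m - \<mu>" | (diff) "V 1 x y \<in> {sqrt m, - sqrt m}" "V 2 x y = 0"
    by blast
  then have "(\<bar>gram x y\<bar> \<noteq> 1 / sqrt m \<longleftrightarrow> (E 0 + E 4) $ x $ y \<noteq> 0) \<and>
      (E 0 + E 4) $ x $ y \<in> {0, m / (\<mu> * real CARD('a))}"
  proof cases
    case same
    have "\<mu> * (1 + V 4 x y) = m" using same(2) by (simp add: algebra_simps)
    then have 1: "1 + V 4 x y = m / \<mu>" using \<mu>_nonzero by (simp add: field_simps)
    have "\<bar>gram x y\<bar> \<noteq> 1 / sqrt m"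
      using same(1) m_pos m_greater_1 by (auto simp: gram_def)
    then show ?thesis unfolding K 1 using m_pos \<mu>_nonzero by simp
  next
    case diff
    then have "V 1 x y \<noteq> 0" using m_pos by auto
    from V_2_V_4(1)[OF this] have "1 + V 4 x y = 0" using diff(2) m_greater_1 by simp
    then have 1: "(E 0 + E 4) $ x $ y = 0" unfolding K by simp
    have "\<bar>gram x y\<bar> = 1 / sqrt m" using diff(1) s m_pos by (auto simp: gram_def)
    then show ?thesis using 1 by simp
  qed
  then show "\<bar>gram x y\<bar> \<noteq> 1 / sqrt m \<longleftrightarrow> (E 0 + E 4) $ x $ y \<noteq> 0"
    and "(E 0 + E 4) $ x $ y \<in> {0, m / (\<mu> * real CARD('a))}" by blast+
qed

text \<open>The class relation is transitive because \<open>E 0 + E 4\<close> is idempotent with nonnegative entries.\<close>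

lemma gram_trans:
  assumes "\<bar>gram x y\<bar> \<noteq> 1 / sqrt m" "\<bar>gram y z\<bar> \<noteq> 1 / sqrt m"
  shows "\<bar>gram x z\<bar> \<noteq> 1 / sqrt m"
proof -
  define K where "K = E 0 + E 4"
  have "K ** K = K" unfolding K_def using E_mult[of 0 0] E_mult[of 0 4] E_mult[of 4 0] E_mult[of 4 4]
    by (simp add: matrix_add_ldistrib matrix_add_rdistrib)
  then have conv: "K $ x $ z = (\<Sum>y\<in>UNIV. K $ x $ y * K $ y $ z)" for x z
    by (metis (no_types, lifting) matrix_matrix_mult_def sum.cong vec_lambda_beta)
  have K_sym: "K $ x $ y = K $ y $ x" for x y
    unfolding K_def using E_sym[of 0 x y] E_sym[of 4 x y] by simp
  define a where "a = m / (\<mu> * real CARD('a))"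
  have vals: "K $ x $ y \<in> {0, a}" for x y unfolding K_def a_def by (rule E_0_4_values)
  have "a \<noteq> 0" unfolding a_def using m_pos \<mu>_nonzero by simp
  have nz: "K $ x $ y = a" "K $ y $ z = a"
    using assms vals[of x y] vals[of y z] unfolding gram_abs_iff K_def by auto
  \<comment> \<open>The sign of \<open>\<mu>\<close>, hence of \<open>a\<close>, is not known
    beforehand. A positive diagonal entry, being a sum of squares, forces \<open>a\<close> to be
    positive.\<close>
  have sq: "K $ x $ x = (\<Sum>y\<in>UNIV. (K $ x $ y)\<^sup>2)"
    unfolding conv[of x x] power2_eq_square by (intro sum.cong refl arg_cong2[of _ _ _ _ times] K_sym)
  have "a\<^sup>2 \<le> (\<Sum>y\<in>UNIV. (K $ x $ y)\<^sup>2)"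
    using member_le_sum[of y UNIV "\<lambda>y. (K $ x $ y)\<^sup>2"] nz by simp
  then have "0 < K $ x $ x" using \<open>a \<noteq> 0\<close> sq zero_less_power2[of a] by linarith
  then have "0 < a" using vals[of x x] by auto
  have "a * a \<le> K $ x $ z"
    unfolding conv[of x z]
    using member_le_sum[of y UNIV "\<lambda>y. K $ x $ y * K $ y $ z"] nz vals \<open>0 < a\<close>
    by (metis (no_types, lifting) UNIV_I finite insertE less_eq_real_def mult_nonneg_nonneg singletonD)
  then have "K $ x $ z \<noteq> 0" using \<open>0 < a\<close> by (metis mult_pos_pos not_le)
  then show ?thesis unfolding gram_abs_iff K_def .
qed

lemma gram_rep: "i \<le> 4 \<Longrightarrow> (x, y) \<in> R i \<longleftrightarrow> gram x y = rep i / m"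
  using rel_iff m_pos by (simp add: gram_def)

lemma gram_image: "(\<lambda>i. rep i / m) ` {..4} = {1, 1 / sqrt m, 0, - (1 / sqrt m), -1}"
proof -
  have "(\<lambda>i. rep i / m) ` {..4} = (\<lambda>\<tau>. \<tau> / m) ` (rep ` {..4})" by (simp add: image_image)
  also have "\<dots> = {1, 1 / sqrt m, 0, - (1 / sqrt m), -1}"
    unfolding rep_image using m_pos sqrt_divide_self_eq[of m] by (auto simp: divide_inverse)
  finally show ?thesis .
qed

lemma ex_gram:
  assumes "\<tau> \<in> {1, 1 / sqrt m, 0, - (1 / sqrt m), -1}"
  shows "\<exists>y. gram x y = \<tau>"
proof -
  obtain i where i: "i \<le> 4" "\<tau> = rep i / m" using assms unfolding gram_image[symmetric] by auto
  then show ?thesis using valency[OF i(1), of x] gram_rep by auto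
qed

text \<open>The dimension \<open>1 / s\<^sup>2\<close> is \<open>m\<close> here, and the convolution
  identity is the idempotence of \<open>E 1\<close>.\<close>

sublocale mub_gram gram "1 / sqrt m" "real CARD('a) / m"
proof
  fix x y z :: 'a
  show "gram x y = gram y x" unfolding gram_def V_def using E_sym[of 1 x y] by simp
  show "gram x x = 1" unfolding gram_def using V_diag m_pos by simp
  have 0: "gram x x = rep 0 / m" for x using gram_rep[of 0 x x] diagonal by auto
  show "x = y" if "gram x y = 1"
  proof -
    have "gram x y = rep 0 / m" using that 0[of x] \<open>gram x x = 1\<close> by simp
    then have "(x, y) \<in> R 0" using gram_rep[of 0 x y] by simp
    then show ?thesis by (simp add: diagonal)
  qed
  show "(\<Sum>z\<in>UNIV. gram x z * gram z y) = real CARD('a) / m * gram x y"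
  proof -
    have "(E 1 ** E 1) $ x $ y = E 1 $ x $ y" using E_mult[of 1 1] by simp
    then have "(\<Sum>z\<in>UNIV. E 1 $ x $ z * E 1 $ z $ y) = E 1 $ x $ y"
      by (simp add: matrix_matrix_mult_def)
    moreover have "(\<Sum>z\<in>UNIV. gram x z * gram z y)
        = (real CARD('a) / m)\<^sup>2 * (\<Sum>z\<in>UNIV. E 1 $ x $ z * E 1 $ z $ y)"
      by (simp add: gram_def V_def sum_distrib_left power2_eq_square mult_ac)
    ultimately show ?thesis by (simp add: gram_def V_def power2_eq_square)
  qed
  show "real CARD('a) / m = real CARD('a) * (1 / sqrt m)\<^sup>2"
    using m_pos by (simp add: power_divide)
  show "gram x y \<in> {1, 1 / sqrt m, 0, - (1 / sqrt m), -1}"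
  proof -
    obtain i where "i \<le> 4" "(x, y) \<in> R i" using ex_rel by blast
    then show ?thesis using gram_rep unfolding gram_image[symmetric] by auto
  qed
  show "0 < 1 / sqrt m" "1 / sqrt m < 1" using m_greater_1 by auto
  show "\<exists>y. gram x y = -1" by (rule ex_gram) simp
  show "\<bar>gram x z\<bar> \<noteq> 1 / sqrt m" if "\<bar>gram x y\<bar> \<noteq> 1 / sqrt m" "\<bar>gram y z\<bar> \<noteq> 1 / sqrt m"
    using that by (rule gram_trans)
qed

section \<open>Class sizes, and the transfer of quadruple regularity\<close>

lemma Q_antipodal_classes_eq: "Q_antipodal_classes 4 E = range cls"
proof -
  have "Q_antipodal_relation 4 E `` {x} = cls x" for x
    unfolding Q_antipodal_relation_def cls_def gram_abs_iff by auto
  then show ?thesis unfolding Q_antipodal_classes_def quotient_def by auto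
qed

lemma card_cls_m: "real (card (cls x)) = 2 * m"
  using card_cls[of x] m_pos by (simp add: power_divide field_simps)

lemma card_Q_antipodal_classes: "real (card (Q_antipodal_classes 4 E)) * (2 * m) = real CARD('a)"
proof -
  have "card (cls undefined) * card (range cls) = card (\<Union> (range cls))"
  proof (rule card_partition)
    show "card c = card (cls undefined)" if "c \<in> range cls" for c
      using that card_cls_eq by auto
    show "c \<inter> c' = {}" if "c \<in> range cls" "c' \<in> range cls" "c \<noteq> c'" for c c'
      using that cls_eq by blast
  qed auto
  moreover have "\<Union> (range cls) = UNIV" using self_in_cls by auto
  ultimately have "real (card (cls undefined)) * real (card (range cls)) = real CARD('a)"
    by (metis of_nat_mult)
  then show ?thesis unfolding Q_antipodal_classes_eq card_cls_m by (simp add: mult_ac)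
qed

text \<open>Classes of size \<open>2 * m\<close> make \<open>\<kappa>\<close> twice the number
  \<open>f\<close> of classes, so \<open>m * \<gamma> = 2 * f - 2\<close>.\<close>

lemma excess_eq_1_iff: "excess = 1 \<longleftrightarrow> real (card (Q_antipodal_classes 4 E)) = m / 2 + 1"
proof -
  have "real CARD('a) / m = 2 * real (card (Q_antipodal_classes 4 E))"
    using card_Q_antipodal_classes m_pos by (simp add: field_simps)
  then have "excess = (2 * real (card (Q_antipodal_classes 4 E)) - 2) / m"
    unfolding excess_def using m_pos by (simp add: power_divide)
  then have "m * excess = 2 * real (card (Q_antipodal_classes 4 E)) - 2" using m_pos by simp
  moreover have "excess = 1 \<longleftrightarrow> m * excess = m" using m_pos by simp
  ultimately show ?thesis by auto
qed

lemma Inter_rel: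
  assumes "\<forall>k\<in>{1..4}. i k \<le> 4"
  shows "(\<Inter>k\<in>{1..4::nat}. R (i k) `` {x k}) = {z. \<forall>k\<in>{1..4}. gram (x k) z = rep (i k) / m}"
  using assms gram_rep by auto

text \<open>Each relation is a level set of \<open>gram\<close>, so prescribing relations amounts to
  prescribing inner products; \<open>t_sym\<close> and \<open>t_refl\<close> extend the pairs
  \<open>k < l\<close> to all pairs.\<close>

lemma quadruply_regular_iff: "quadruply_regular 4 R \<longleftrightarrow> regular4"
proof
  assume reg: "quadruply_regular 4 R"
  show regular4
    unfolding regular4_def
  proof (intro allI impI)
    fix x y :: "nat \<Rightarrow> 'a" and \<beta> :: "nat \<Rightarrow> real"
    assume xy: "congruent4 x y"
    show "card {z. \<forall>k\<in>{1..4}. gram (x k) z = \<beta> k} = card {z. \<forall>k\<in>{1..4}. gram (y k) z = \<beta> k}"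
    proof (cases "\<forall>k\<in>{1..4}. \<beta> k \<in> (\<lambda>i. rep i / m) ` {..4}")
      case True
      then have "\<forall>k\<in>{1..4}. \<exists>i\<le>4. \<beta> k = rep i / m" by auto
      then obtain i where i: "\<And>k. k \<in> {1..4} \<Longrightarrow> i k \<le> 4" "\<And>k. k \<in> {1..4} \<Longrightarrow> \<beta> k = rep (i k) / m"
        by (metis (no_types, lifting))
      have "\<exists>j\<le>4. (x k, x l) \<in> R j" for k l by (rule ex_rel)
      then obtain j where j: "\<And>k l. j k l \<le> 4" "\<And>k l. (x k, x l) \<in> R (j k l)" by metis
      have jy: "(y k, y l) \<in> R (j k l)" if "k \<in> {1..4}" "l \<in> {1..4}" for k l
      proof -
        have "gram (y k) (y l) = gram (x k) (x l)" using xy that unfolding congruent4_def by simp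
        then show ?thesis using j[of k l] gram_rep by simp
      qed
      obtain N where N: "\<And>x. \<forall>k\<in>{1..4}. \<forall>l\<in>{1..4}. k < l \<longrightarrow> (x k, x l) \<in> R (j k l) \<Longrightarrow>
          card (\<Inter>k\<in>{1..4}. R (i k) `` {x k}) = N"
        using reg[unfolded quadruply_regular_def, rule_format, of i j] i j by blast
      have "{z. \<forall>k\<in>{1..4}. gram (x k) z = \<beta> k} = (\<Inter>k\<in>{1..4}. R (i k) `` {x k})" for x
        using i by (subst Inter_rel) auto
      then show ?thesis using N[of x] N[of y] j jy by simp
    next
      case False
      \<comment> \<open>A value attained by no relation makes both counts zero.\<close>
      then obtain k where "k \<in> {1..4}" "\<beta> k \<notin> {1, 1 / sqrt m, 0, - (1 / sqrt m), -1}"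
        unfolding gram_image by blast
      then have "gram u z \<noteq> \<beta> k" for u z using t_values[of u z] by metis
      then have "{z. \<forall>k\<in>{1..4}. gram (x k) z = \<beta> k} = {}" for x
        using \<open>k \<in> {1..4}\<close> by blast
      then show ?thesis by (simp only:)
    qed
  qed
next
  assume reg: regular4
  show "quadruply_regular 4 R"
    unfolding quadruply_regular_def
  proof (intro allI impI)
    fix i :: "nat \<Rightarrow> nat" and j :: "nat \<Rightarrow> nat \<Rightarrow> nat"
    assume i: "\<forall>k\<in>{1..4}. i k \<le> 4" and j: "\<forall>k\<in>{1..4}. \<forall>l\<in>{1..4}. k < l \<longrightarrow> j k l \<le> 4"
    define P where "P x \<longleftrightarrow> (\<forall>k\<in>{1..4}. \<forall>l\<in>{1..4}. k < l \<longrightarrow> (x k, x l) \<in> R (j k l))" for x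
    define c where "c x = card (\<Inter>k\<in>{1..4}. R (i k) `` {x k})" for x :: "nat \<Rightarrow> 'a"
    have eq: "c x = c y" if "P x" "P y" for x y
    proof -
      have lt: "gram (x k) (x l) = gram (y k) (y l)" if "k \<in> {1..4}" "l \<in> {1..4}" "k < l" for k l
        using \<open>P x\<close> \<open>P y\<close> that j gram_rep unfolding P_def by metis
      have "congruent4 x y"
        unfolding congruent4_def
      proof (intro ballI)
        fix k l :: nat assume kl: "k \<in> {1..4}" "l \<in> {1..4}"
        consider "k < l" | "k = l" | "l < k" by linarith
        then show "gram (x k) (x l) = gram (y k) (y l)"
          using lt[of k l] lt[of l k] kl t_sym t_refl by cases metis+
      qed
      then show ?thesis unfolding c_def Inter_rel[OF i]
        using reg[unfolded regular4_def, THEN spec, THEN spec, THEN spec[of _ "\<lambda>k. rep (i k) / m"]]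
        by simp
    qed
    have "\<exists>N. \<forall>x. P x \<longrightarrow> c x = N"
    proof (cases "\<exists>x. P x")
      case True
      then obtain x where "P x" by blast
      then show ?thesis using eq by blast
    next
      case False
      then show ?thesis by blast
    qed
    then show "\<exists>N. \<forall>x. (\<forall>k\<in>{1..4}. \<forall>l\<in>{1..4}. k < l \<longrightarrow> (x k, x l) \<in> R (j k l)) \<longrightarrow>
        card (\<Inter>k\<in>{1..4}. R (i k) `` {x k}) = N"
      unfolding P_def c_def .
  qed
qed

text \<open>From any point all five inner products occur. This supplies an orthogonal pair, and also
  a point outside a given class, so that \<open>\<kappa>\<close> exceeds 2.\<close>

lemma regular_iff_excess: "regular4 \<longleftrightarrow> excess = 1"
proof
  assume reg: regular4
  obtain b where b: "gram undefined b = 0" using ex_gram[of 0 undefined] by auto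
  obtain y where "gram undefined y = 1 / sqrt m" using ex_gram[of "1 / sqrt m" undefined] by auto
  then have "y \<notin> cls undefined" using m_pos by (simp add: cls_def)
  then have "card (cls undefined) < CARD('a)" by (intro psubset_card_mono) auto
  then have "2 * m < real CARD('a)" using card_cls_m[of undefined] by linarith
  then have "2 < real CARD('a) / m" using m_pos by (simp add: field_simps)
  then show "excess = 1" by (rule excess_eq_1_if_regular[OF reg b])
qed (rule regular_if_excess_eq_1)

end

theorem theorem4p3:
  fixes R :: "nat \<Rightarrow> 'a::finite rel"
    and E :: "nat \<Rightarrow> real^'a^'a"
    and f :: nat and d :: real
  assumes "symmetric_association_scheme 4 R"
    and "idempotent_ordering 4 R E"
    and "Q_polynomial 4 E"
    and "Q_antipodal 4 E"
    and "Q_bipartite 4 E"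
    and "f = card (Q_antipodal_classes 4 E)"
    and "\<And>C. C \<in> Q_antipodal_classes 4 E \<Longrightarrow> real (card C) = 2 * d"
  shows "quadruply_regular 4 R \<longleftrightarrow> real f = d / 2 + 1"
proof -
  interpret symmetric_association_scheme 4 R by (rule assms(1))
  interpret bipartite_antipodal_scheme R E
    by unfold_locales (use assms in auto)
  have "real (card (cls undefined)) = 2 * d"
    by (rule assms(7)) (simp add: Q_antipodal_classes_eq)
  then have "d = m" using card_cls_m[of undefined] by simp
  then show ?thesis
    unfolding quadruply_regular_iff regular_iff_excess excess_eq_1_iff assms(6) by simp
qed

end
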